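(* Let $(W,S)$ be a Coxeter system, let $I,J\subset S$ be finitary subsets, and let $p,q$ be $(I,J)$-cosets. The following conditions are equivalent. (1) $\overline{p}\leq \overline{q}$ in the Bruhat order on $W$. (2) $\underline{p}\leq \underline{q}$ in the Bruhat order on $W$ (i.e. $p\leq q$). (3) There exist a reduced expression $I_\bullet$ expressing $q$ and a path $p_\bullet$ subordinate to $I_\bullet$ such that $p=\mathrm{term}(p_\bullet)$. (4) For any (not necessarily reduced) expression $I_\bullet$ expressing $q$, there exists a path $p_\bullet$ subordinate to $I_\bullet$ such that $p=\mathrm{term}(p_\bullet)$.
   Context: $(W,S)$ is a Coxeter system with length function $\ell$. For $I\subset S$, $W_I$ is the subgroup generated by $I$; $I$ is finitary if $W_I$ is finite, and then $w_I$ is its longest element. The $*$-product on $W$ is the associative monoid product determined by $s*w=sw$ if $sw>w$ and $s*w=w$ if $sw<w$ ($s\in S$, $w\in W$), with unit the identity. An $(I,J)$-coset is an element $p\in W_I\backslash W/W_J$ (regarded as a triple $(p,I,J)$). $\overline{p}$ and $\underline{p}$ denote the maximal and minimal elements of the set $p$ in the Bruhat order. For $(I,J)$-cosets, $p\le q$ means $\underline p\le\underline q$. A (singlestep) expression, called an $(I,J)$-expression when $I_0=I$ and $I_d=J$, is a sequence $I_\bullet=[I_0,I_1,\dots,I_d]$ of finitary subsets of $S$ such that each $I_k$ is obtained from $I_{k-1}$ by adding or removing one element of $S$. It expresses the unique $(I_0,I_d)$-coset $q$ with $\overline{q}=w_{I_0}*w_{I_1}*\cdots*w_{I_d}$. Reduced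 expressions: recording the local maxima and minima of $I_\bullet$ gives a multistep expression $I_0=L_0\subset K_1\supset L_1\subset K_2\supset\cdots\subset K_m\supset L_m=I_d$ (with $L_0=K_1$ if $I_\bullet$ starts by decreasing and $K_m=L_m$ if it ends by increasing). $I_\bullet$, expressing $q$, is reduced if $\overline{q}=(w_{K_1}w_{L_1}^{-1})(w_{K_2}w_{L_2}^{-1})\cdots(w_{K_{m-1}}w_{L_{m-1}}^{-1})\,w_{K_m}$ and the length of $\overline q$ is the sum of the lengths of these factors. A path subordinate to $I_\bullet=[I_0,\dots,I_d]$ is a sequence $p_\bullet=[p_0,\dots,p_d]$ where $p_k$ is an $(I_0,I_k)$-coset, $p_0$ is the $(I_0,I_0)$-coset containing the identity, and for each $k$: if $I_k\subset I_{k+1}$ then $p_{k+1}$ is the unique $(I_0,I_{k+1})$-coset containing $p_k$; if $I_k\supset I_{k+1}$ then $p_{k+1}$ is one of the $(I_0,I_{k+1})$-cosets contained in $p_k$. Its terminus is $\mathrm{term}(p_\bullet)=p_d$. *)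

theory Defs
  imports "HOL-Algebra.Algebra"
begin

section \<open>Coxeter systems\<close>

definition group_prod :: "('a, 'b) monoid_scheme \<Rightarrow> 'a list \<Rightarrow> 'a" where
  "group_prod W xs = foldr (\<lambda>x y. x \<otimes>\<^bsub>W\<^esub> y) xs \<one>\<^bsub>W\<^esub>"

text \<open>
  The congruence on words over \<open>S\<close> generated by \<open>(st)\<^sup>m \<sim> 1\<close>, where \<open>m\<close> is the order of \<open>st\<close> in \<open>W\<close>.
  Since \<open>group.ord\<close> is \<open>0\<close> for elements of infinite order, the rule \<open>rel\<close> is trivial for such
  pairs; for \<open>s = t\<close> it reads \<open>ss \<sim> 1\<close>.  The latter makes every generator its own inverse, so
  words without formal inverses suffice to describe the group presented by these relations.
\<close>

inductive coxeter_equiv :: "('a, 'b) monoid_scheme \<Rightarrow> 'a set \<Rightarrow> 'a list \<Rightarrow> 'a list \<Rightarrow> bool"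
  for W S where
  rel: "\<lbrakk>s \<in> S; t \<in> S; set us \<subseteq> S; set vs \<subseteq> S\<rbrakk> \<Longrightarrow>
     coxeter_equiv W S
       (us @ concat (replicate (group.ord W (s \<otimes>\<^bsub>W\<^esub> t)) [s, t]) @ vs) (us @ vs)"
| refl: "set us \<subseteq> S \<Longrightarrow> coxeter_equiv W S us us"
| sym: "coxeter_equiv W S us vs \<Longrightarrow> coxeter_equiv W S vs us"
| trans: "coxeter_equiv W S us vs \<Longrightarrow> coxeter_equiv W S vs ws \<Longrightarrow> coxeter_equiv W S us ws"

text \<open>
  \<open>W\<close> is presented by the set \<open>S\<close> of generators of order 2, with the relations
  \<open>(st)\<^sup>m\<^sup>(\<^sup>s\<^sup>,\<^sup>t\<^sup>) = 1\<close> for those \<open>s, t\<close> for which the order \<open>m(s,t)\<close> of \<open>st\<close> is finite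
  (Bourbaki, Lie IV.1.3).  The set \<open>S\<close> may be infinite.
\<close>

locale coxeter_system = group W
  for W :: "('a, 'b) monoid_scheme" (structure) +
  fixes S :: "'a set"
  assumes gens_closed: "S \<subseteq> carrier W"
    and gens_order: "\<And>s. s \<in> S \<Longrightarrow> ord s = 2"
    and gens_generate: "generate W S = carrier W"
    and presentation: "\<And>us vs. \<lbrakk>set us \<subseteq> S; set vs \<subseteq> S; group_prod W us = group_prod W vs\<rbrakk>
      \<Longrightarrow> coxeter_equiv W S us vs"

definition cox_length :: "('a, 'b) monoid_scheme \<Rightarrow> 'a set \<Rightarrow> 'a \<Rightarrow> nat" where
  "cox_length W S w = (LEAST n. \<exists>us. set us \<subseteq> S \<and> length us = n \<and> group_prod W us = w)"

definition reflections :: "('a, 'b) monoid_scheme \<Rightarrow> 'a set \<Rightarrow> 'a set" where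
  "reflections W S = {x \<otimes>\<^bsub>W\<^esub> s \<otimes>\<^bsub>W\<^esub> inv\<^bsub>W\<^esub> x | x s. x \<in> carrier W \<and> s \<in> S}"

inductive bruhat_le :: "('a, 'b) monoid_scheme \<Rightarrow> 'a set \<Rightarrow> 'a \<Rightarrow> 'a \<Rightarrow> bool"
  for W S where
  refl: "x \<in> carrier W \<Longrightarrow> bruhat_le W S x x"
| step: "\<lbrakk>bruhat_le W S x y; t \<in> reflections W S;
     cox_length W S y < cox_length W S (y \<otimes>\<^bsub>W\<^esub> t)\<rbrakk> \<Longrightarrow> bruhat_le W S x (y \<otimes>\<^bsub>W\<^esub> t)"

definition bruhat_less :: "('a, 'b) monoid_scheme \<Rightarrow> 'a set \<Rightarrow> 'a \<Rightarrow> 'a \<Rightarrow> bool" where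
  "bruhat_less W S x y \<longleftrightarrow> bruhat_le W S x y \<and> x \<noteq> y"

definition finitary :: "('a, 'b) monoid_scheme \<Rightarrow> 'a set \<Rightarrow> 'a set \<Rightarrow> bool" where
  "finitary W S I \<longleftrightarrow> I \<subseteq> S \<and> finite (generate W I)"

definition longest :: "('a, 'b) monoid_scheme \<Rightarrow> 'a set \<Rightarrow> 'a set \<Rightarrow> 'a" where
  "longest W S I = (THE w. w \<in> generate W I \<and>
     (\<forall>v\<in>generate W I. cox_length W S v \<le> cox_length W S w))"

definition is_star_product :: "('a, 'b) monoid_scheme \<Rightarrow> 'a set \<Rightarrow> ('a \<Rightarrow> 'a \<Rightarrow> 'a) \<Rightarrow> bool" where
  "is_star_product W S f \<longleftrightarrow>
     (\<forall>x\<in>carrier W. \<forall>y\<in>carrier W. f x y \<in> carrier W) \<and>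
     (\<forall>x\<in>carrier W. \<forall>y\<in>carrier W. \<forall>z\<in>carrier W. f (f x y) z = f x (f y z)) \<and>
     (\<forall>x\<in>carrier W. f \<one>\<^bsub>W\<^esub> x = x \<and> f x \<one>\<^bsub>W\<^esub> = x) \<and>
     (\<forall>s\<in>S. \<forall>w\<in>carrier W.
        (bruhat_less W S w (s \<otimes>\<^bsub>W\<^esub> w) \<longrightarrow> f s w = s \<otimes>\<^bsub>W\<^esub> w) \<and>
        (bruhat_less W S (s \<otimes>\<^bsub>W\<^esub> w) w \<longrightarrow> f s w = w))"

text \<open>
  The conditions determine the product on \<open>carrier W\<close>, the only place where it is used; off the
  carrier it is arbitrary, hence \<open>SOME\<close> rather than \<open>THE\<close>.
\<close>

definition star :: "('a, 'b) monoid_scheme \<Rightarrow> 'a set \<Rightarrow> 'a \<Rightarrow> 'a \<Rightarrow> 'a" where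
  "star W S = (SOME f. is_star_product W S f)"

definition star_prod :: "('a, 'b) monoid_scheme \<Rightarrow> 'a set \<Rightarrow> 'a list \<Rightarrow> 'a" where
  "star_prod W S xs = foldr (star W S) xs \<one>\<^bsub>W\<^esub>"


section \<open>Double cosets\<close>

text \<open>
  An \<open>(I,J)\<close>-coset is represented by its underlying set; the labels \<open>I\<close> and \<open>J\<close> are always
  passed separately.
\<close>

definition double_cosets :: "('a, 'b) monoid_scheme \<Rightarrow> 'a set \<Rightarrow> 'a set \<Rightarrow> 'a set set" where
  "double_cosets W I J =
     {(generate W I #>\<^bsub>W\<^esub> x) <#>\<^bsub>W\<^esub> generate W J | x. x \<in> carrier W}"

definition coset_max :: "('a, 'b) monoid_scheme \<Rightarrow> 'a set \<Rightarrow> 'a set \<Rightarrow> 'a" where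
  "coset_max W S p = (THE x. x \<in> p \<and> (\<forall>y\<in>p. bruhat_le W S y x))"

definition coset_min :: "('a, 'b) monoid_scheme \<Rightarrow> 'a set \<Rightarrow> 'a set \<Rightarrow> 'a" where
  "coset_min W S p = (THE x. x \<in> p \<and> (\<forall>y\<in>p. bruhat_le W S x y))"


section \<open>Singlestep expressions\<close>

definition is_expression :: "('a, 'b) monoid_scheme \<Rightarrow> 'a set \<Rightarrow> 'a set list \<Rightarrow> bool" where
  "is_expression W S Is \<longleftrightarrow> Is \<noteq> [] \<and> (\<forall>I\<in>set Is. finitary W S I) \<and>
     (\<forall>k. Suc k < length Is \<longrightarrow>
        (\<exists>s\<in>S. (s \<notin> Is ! k \<and> Is ! Suc k = insert s (Is ! k)) \<or>
               (s \<in> Is ! k \<and> Is ! Suc k = Is ! k - {s})))"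

definition expresses ::
  "('a, 'b) monoid_scheme \<Rightarrow> 'a set \<Rightarrow> 'a set \<Rightarrow> 'a set \<Rightarrow> 'a set list \<Rightarrow> 'a set \<Rightarrow> bool" where
  "expresses W S I J Is q \<longleftrightarrow>
     is_expression W S Is \<and> hd Is = I \<and> last Is = J \<and> q \<in> double_cosets W I J \<and>
     coset_max W S q = star_prod W S (map (longest W S) Is)"

text \<open>
  \<open>local_maxima Is\<close> is \<open>[K\<^sub>1, \<dots>, K\<^sub>m]\<close>, with the end points of \<open>Is\<close> included where they are local
  maxima, i.e. \<open>K\<^sub>1 = L\<^sub>0\<close> if \<open>Is\<close> starts by decreasing and \<open>K\<^sub>m = L\<^sub>m\<close> if it ends by
  increasing (and \<open>m = 1\<close> if \<open>Is\<close> has only one entry).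
  \<open>inner_minima Is\<close> is \<open>[L\<^sub>1, \<dots>, L\<^sub>m\<^sub>-\<^sub>1]\<close>: the end points \<open>L\<^sub>0\<close> and \<open>L\<^sub>m\<close> are left
  out, as they do not occur in the formula defining reducedness.
\<close>

definition local_maxima :: "'a set list \<Rightarrow> 'a set list" where
  "local_maxima Is = [Is ! k. k \<leftarrow> [0..<length Is],
     (k = 0 \<or> Is ! (k - 1) \<subset> Is ! k) \<and> (Suc k = length Is \<or> Is ! Suc k \<subset> Is ! k)]"

definition inner_minima :: "'a set list \<Rightarrow> 'a set list" where
  "inner_minima Is = [Is ! k. k \<leftarrow> [0..<length Is],
     0 < k \<and> Suc k < length Is \<and> Is ! k \<subset> Is ! (k - 1) \<and> Is ! k \<subset> Is ! Suc k]"

text \<open>The list \<open>[w\<^bsub>K\<^sub>1\<^esub> w\<^bsub>L\<^sub>1\<^esub>\<inverse>, \<dots>, w\<^bsub>K\<^sub>m\<^sub>-\<^sub>1\<^esub> w\<^bsub>L\<^sub>m\<^sub>-\<^sub>1\<^esub>\<inverse>, w\<^bsub>K\<^sub>m\<^esub>]\<close>.\<close>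

definition expression_factors ::
  "('a, 'b) monoid_scheme \<Rightarrow> 'a set \<Rightarrow> 'a set list \<Rightarrow> 'a list" where
  "expression_factors W S Is =
     map2 (\<lambda>K L. longest W S K \<otimes>\<^bsub>W\<^esub> inv\<^bsub>W\<^esub> (longest W S L))
       (butlast (local_maxima Is)) (inner_minima Is)
     @ [longest W S (last (local_maxima Is))]"

definition reduced_expresses ::
  "('a, 'b) monoid_scheme \<Rightarrow> 'a set \<Rightarrow> 'a set \<Rightarrow> 'a set \<Rightarrow> 'a set list \<Rightarrow> 'a set \<Rightarrow> bool" where
  "reduced_expresses W S I J Is q \<longleftrightarrow>
     expresses W S I J Is q \<and>
     coset_max W S q = group_prod W (expression_factors W S Is) \<and>
     cox_length W S (coset_max W S q) = sum_list (map (cox_length W S) (expression_factors W S Is))"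

definition subordinate_path ::
  "('a, 'b) monoid_scheme \<Rightarrow> 'a set list \<Rightarrow> 'a set list \<Rightarrow> bool" where
  "subordinate_path W Is ps \<longleftrightarrow>
     length ps = length Is \<and>
     (\<forall>k < length Is. ps ! k \<in> double_cosets W (Is ! 0) (Is ! k)) \<and>
     \<one>\<^bsub>W\<^esub> \<in> ps ! 0 \<and>
     (\<forall>k. Suc k < length Is \<longrightarrow>
        (Is ! k \<subset> Is ! Suc k \<longrightarrow> ps ! k \<subseteq> ps ! Suc k) \<and>
        (Is ! Suc k \<subset> Is ! k \<longrightarrow> ps ! Suc k \<subseteq> ps ! k))"

end

theory Submission
  imports Defs
begin

text \<open>
  Let \<open>B(y)\<close> be the set of elements below \<open>y\<close> in the Bruhat order.  The lifting property gives
  \<open>B(sw) = {1, s} B(w)\<close> whenever \<open>sw > w\<close>, so that \<open>B(x * y) = B(x) B(y)\<close>; as \<open>B\<close> is injective, this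
  determines the \<open>*\<close>-product and makes its associativity evident.  Since \<open>B(w\<^sub>I) = W\<^sub>I\<close>, an expression
  \<open>[I\<^sub>0, \<dots>, I\<^sub>d]\<close> of \<open>q\<close> satisfies \<open>B(max q) = W(I\<^sub>0) \<cdots> W(I\<^sub>d)\<close>, where \<open>W(I) = W\<^sub>I\<close>.
  The termini of its subordinate paths are precisely the cosets contained in this product, i.e. the
  cosets \<open>p\<close> with \<open>max p \<le> max q\<close>, whichever expression is used.  What remains is the existence of a reduced expression.
\<close>

text \<open>The bridge is the parity with which a reflection occurs among those attached to a word.
  It is invariant under the Coxeter relations and satisfies a cocycle rule, from which strong
  exchange, lifting and additivity of length over minimal coset representatives follow. The equation
  for \<open>B(max q)\<close> speaks of star products only and cannot detect reducedness, which
  concerns ordinary products and lengths. The two meet where lengths add: there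
  \<open>B(uv) = B(u) B(v)\<close>, so an ordinary factorisation can be recognised by its lower set.
  The construction of a reduced expression therefore carries along the product of parabolics, the
  ordinary product of the factors and their total length. Minima are compared by cancellation
  instead: if \<open>x\<close> has no left descents in \<open>I\<close>, then \<open>x\<close> below
  \<open>a z\<close> with \<open>a\<close> in \<open>W_I\<close> already gives \<open>x\<close>
  below \<open>z\<close>. The same cancellation yields the existence of minima, descents inside
  parabolics and the length formulas.\<close>

context coxeter_system
begin

section \<open>Words and lengths\<close>

abbreviation wprod :: "'a list \<Rightarrow> 'a" where "wprod \<equiv> group_prod W"
abbreviation len :: "'a \<Rightarrow> nat" where "len \<equiv> cox_length W S"
abbreviation par :: "'a set \<Rightarrow> 'a set" where "par \<equiv> generate W"
abbreviation refls :: "'a set" where "refls \<equiv> reflections W S"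

lemma wprod_simps [simp]: "wprod [] = \<one>" "wprod (s # ws) = s \<otimes> wprod ws"
  by (simp_all add: group_prod_def)

lemma gen_carrier [simp]: "s \<in> S \<Longrightarrow> s \<in> carrier W"
  using gens_closed by blast

lemma gen_square [simp]: "s \<in> S \<Longrightarrow> s \<otimes> s = \<one>"
  using pow_ord_eq_1[of s] gens_order[of s] by (simp add: numeral_2_eq_2)

lemma gen_inv [simp]: "s \<in> S \<Longrightarrow> inv s = s"
  by (simp add: inv_equality)

lemma gen_cancel [simp]: "s \<in> S \<Longrightarrow> x \<in> carrier W \<Longrightarrow> s \<otimes> (s \<otimes> x) = x"
  by (simp flip: m_assoc)

lemma inv_cancel [simp]:
  assumes "a \<in> carrier W" "x \<in> carrier W"
  shows "inv a \<otimes> (a \<otimes> x) = x" and "a \<otimes> (inv a \<otimes> x) = x"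
  using assms by (simp_all flip: m_assoc)

lemma gen_neq_one: "s \<in> S \<Longrightarrow> s \<noteq> \<one>"
  using gens_order[of s] ord_eq_1[of s] by auto

lemma wprod_closed [simp]: "set ws \<subseteq> S \<Longrightarrow> wprod ws \<in> carrier W"
  by (induction ws) auto

lemma group_prod_closed: "set xs \<subseteq> carrier W \<Longrightarrow> wprod xs \<in> carrier W"
  by (induction xs) auto

lemma group_prod_append:
  "set us \<subseteq> carrier W \<Longrightarrow> set vs \<subseteq> carrier W \<Longrightarrow> wprod (us @ vs) = wprod us \<otimes> wprod vs"
  by (induction us) (auto simp: group_prod_closed m_assoc)

lemma wprod_append: "set us \<subseteq> S \<Longrightarrow> set vs \<subseteq> S \<Longrightarrow> wprod (us @ vs) = wprod us \<otimes> wprod vs"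
  using group_prod_append gens_closed by (meson subset_trans)

lemma par_closed: "I \<subseteq> S \<Longrightarrow> par I \<subseteq> carrier W"
  using generate_incl gens_closed by (meson subset_trans)

lemma par_subgroup: "I \<subseteq> S \<Longrightarrow> subgroup (par I) W"
  using generate_is_subgroup gens_closed by (meson subset_trans)

lemma par_gen: "s \<in> I \<Longrightarrow> s \<in> par I"
  by (rule generate.incl)

text \<open>Generators are involutions, so an inverse of a generator is a letter again. This is what
  makes the inverse-free rule \<open>par_induct\<close> possible.\<close>

lemma par_word:
  assumes "I \<subseteq> S" "a \<in> par I"
  shows "\<exists>ws. set ws \<subseteq> I \<and> wprod ws = a"
  using assms(2)
proof induction
  case one
  then show ?case by (intro exI[of _ "[]"]) simp
next
  case (incl h)
  then show ?case using assms(1) by (intro exI[of _ "[h]"]) auto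
next
  case (inv h)
  then show ?case using assms(1) by (intro exI[of _ "[h]"]) auto
next
  case (eng h1 h2)
  then obtain us vs where "set us \<subseteq> I" "wprod us = h1" "set vs \<subseteq> I" "wprod vs = h2" by auto
  then show ?case using assms(1) by (intro exI[of _ "us @ vs"]) (auto simp: wprod_append)
qed

lemma par_induct [consumes 2, case_names one mult]:
  assumes "a \<in> par I" "I \<subseteq> S" and "P \<one>"
    and "\<And>s a. s \<in> I \<Longrightarrow> a \<in> par I \<Longrightarrow> P a \<Longrightarrow> P (s \<otimes> a)"
  shows "P a"
proof -
  obtain ws where "set ws \<subseteq> I" "wprod ws = a" using par_word assms by blast
  moreover have "set ws \<subseteq> I \<Longrightarrow> wprod ws \<in> par I \<and> P (wprod ws)" for ws
    by (induction ws) (auto simp: assms generate.one intro: generate.eng par_gen)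
  ultimately show ?thesis by blast
qed

lemma word_exists: "w \<in> carrier W \<Longrightarrow> \<exists>ws. set ws \<subseteq> S \<and> wprod ws = w"
  using par_word[of S w] gens_generate by auto

lemma len_le: "set ws \<subseteq> S \<Longrightarrow> len (wprod ws) \<le> length ws"
  unfolding cox_length_def by (rule Least_le) blast

lemma reduced_word_exists:
  assumes "w \<in> carrier W"
  shows "\<exists>ws. set ws \<subseteq> S \<and> wprod ws = w \<and> length ws = len w"
proof -
  have "\<exists>n ws. set ws \<subseteq> S \<and> length ws = n \<and> wprod ws = w"
    using word_exists[OF assms] by blast
  from LeastI_ex[OF this] show ?thesis unfolding cox_length_def by blast
qed

lemma len_one [simp]: "len \<one> = 0"
  using len_le[of "[]"] by simp

lemma len_eq_0: "w \<in> carrier W \<Longrightarrow> len w = 0 \<longleftrightarrow> w = \<one>"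
  using reduced_word_exists[of w] by auto

lemma len_mult_le:
  assumes "u \<in> carrier W" "v \<in> carrier W"
  shows "len (u \<otimes> v) \<le> len u + len v"
proof -
  obtain us vs where "set us \<subseteq> S" "wprod us = u" "length us = len u"
    "set vs \<subseteq> S" "wprod vs = v" "length vs = len v"
    using reduced_word_exists assms by metis
  then show ?thesis using len_le[of "us @ vs"] by (simp add: wprod_append)
qed

lemma len_inv [simp]:
  assumes "w \<in> carrier W"
  shows "len (inv w) = len w"
proof -
  have rev: "set ws \<subseteq> S \<Longrightarrow> wprod (rev ws) = inv (wprod ws)" for ws
    by (induction ws) (auto simp: wprod_append inv_mult_group)
  have "len (inv w) \<le> len w" if w: "w \<in> carrier W" for w
  proof -
    obtain ws where "set ws \<subseteq> S" "wprod ws = w" "length ws = len w"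
      using reduced_word_exists w by blast
    then show ?thesis using len_le[of "rev ws"] rev[of ws] by simp
  qed
  from this[of w] this[of "inv w"] assms show ?thesis by simp
qed

lemma len_gen [simp]: "s \<in> S \<Longrightarrow> len s = 1"
  using len_le[of "[s]"] len_eq_0[of s] gen_neq_one[of s] by (cases "len s") auto

lemma reflsE:
  assumes "t \<in> refls"
  obtains x s where "x \<in> carrier W" "s \<in> S" "t = x \<otimes> s \<otimes> inv x"
  using assms by (auto simp: reflections_def)

lemma refl_carrier [simp]: "t \<in> refls \<Longrightarrow> t \<in> carrier W"
  by (erule reflsE) simp

lemma gen_refl [simp]: "s \<in> S \<Longrightarrow> s \<in> refls"
  unfolding reflections_def by (rule CollectI, rule exI[of _ \<one>], rule exI[of _ s]) simp

lemma refl_conj: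
  assumes "t \<in> refls" "u \<in> carrier W"
  shows "u \<otimes> t \<otimes> inv u \<in> refls"
proof -
  obtain x s where "x \<in> carrier W" "s \<in> S" "t = x \<otimes> s \<otimes> inv x" using assms(1) by (rule reflsE)
  then have "u \<otimes> t \<otimes> inv u = (u \<otimes> x) \<otimes> s \<otimes> inv (u \<otimes> x)"
    using assms(2) by (simp add: inv_mult_group m_assoc)
  then show ?thesis using \<open>x \<in> _\<close> \<open>s \<in> S\<close> assms(2) unfolding reflections_def by blast
qed

lemma refl_conj': "t \<in> refls \<Longrightarrow> u \<in> carrier W \<Longrightarrow> inv u \<otimes> t \<otimes> u \<in> refls"
  using refl_conj[of t "inv u"] by simp

lemma refl_square [simp]:
  assumes "t \<in> refls" shows "t \<otimes> t = \<one>"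
proof -
  obtain x s where "x \<in> carrier W" "s \<in> S" "t = x \<otimes> s \<otimes> inv x" using assms by (rule reflsE)
  moreover have "inv x \<otimes> (x \<otimes> (s \<otimes> inv x)) = s \<otimes> inv x" if "x \<in> carrier W" "s \<in> S" for x s
    using that by (simp flip: m_assoc)
  ultimately show ?thesis by (simp add: m_assoc)
qed

section \<open>The reflection cocycle\<close>

text \<open>The reflections \<open>s\<^sub>1 \<dots> s\<^sub>i \<dots> s\<^sub>1\<close> attached to a word \<open>s\<^sub>1 \<dots> s\<^sub>n\<close>, with multiplicity.\<close>

fun word_refls :: "'a list \<Rightarrow> 'a list" where
  "word_refls [] = []"
| "word_refls (s # ws) = s # map (\<lambda>t. s \<otimes> t \<otimes> s) (word_refls ws)"

text \<open>The classical sign cocycle. Parity is recorded because a relator contributes every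
  reflection an even number of times, so that parity passes from words to elements of
  \<open>W\<close>.\<close>

definition odd_refl :: "'a list \<Rightarrow> 'a \<Rightarrow> bool" where
  "odd_refl ws t \<longleftrightarrow> odd (count_list (word_refls ws) t)"

lemma word_refls_closed: "I \<subseteq> S \<Longrightarrow> set ws \<subseteq> I \<Longrightarrow> set (word_refls ws) \<subseteq> par I"
  by (induction ws) (auto intro: generate.eng par_gen)

lemma word_refls_carrier: "set ws \<subseteq> S \<Longrightarrow> set (word_refls ws) \<subseteq> carrier W"
  using word_refls_closed[of S ws] gens_generate by simp

lemma word_refls_append:
  assumes "set us \<subseteq> S" "set vs \<subseteq> S"
  shows "word_refls (us @ vs) =
    word_refls us @ map (\<lambda>t. wprod us \<otimes> t \<otimes> inv (wprod us)) (word_refls vs)"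
  using assms
proof (induction us)
  case Nil
  then show ?case using word_refls_carrier[of vs] by (auto simp: map_idI subset_iff)
next
  case (Cons s us)
  have "t \<in> carrier W" if "t \<in> set (word_refls vs)" for t
    using word_refls_carrier[of vs] Cons.prems that by auto
  with Cons show ?case by (auto simp: inv_mult_group m_assoc)
qed

lemma count_list_map_conj:
  assumes "u \<in> carrier W" "t \<in> carrier W" "set xs \<subseteq> carrier W"
  shows "count_list (map (\<lambda>t. u \<otimes> t \<otimes> inv u) xs) t = count_list xs (inv u \<otimes> t \<otimes> u)"
  using assms(3)
proof (induction xs)
  case (Cons x xs)
  have x: "x \<in> carrier W" using Cons.prems by simp
  have "u \<otimes> x \<otimes> inv u = t \<longleftrightarrow> u \<otimes> x = t \<otimes> u"
    using assms x inv_solve_right'[of t "u \<otimes> x" u] by auto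
  also have "\<dots> \<longleftrightarrow> x = inv u \<otimes> t \<otimes> u"
    using assms x by (auto simp: m_assoc inv_solve_left)
  finally have "u \<otimes> x \<otimes> inv u = t \<longleftrightarrow> x = inv u \<otimes> t \<otimes> u" .
  with Cons show ?case by auto
qed simp

text \<open>With N(u) the set of reflections of odd multiplicity, this is the rule N(uv) = N(u) + u
  N(v) u^-1, where + is symmetric difference.\<close>

lemma odd_refl_append:
  assumes "set us \<subseteq> S" "set vs \<subseteq> S" "t \<in> carrier W"
  shows "odd_refl (us @ vs) t \<longleftrightarrow>
    (odd_refl us t \<noteq> odd_refl vs (inv (wprod us) \<otimes> t \<otimes> wprod us))"
  using assms word_refls_carrier[of vs]
  by (simp add: odd_refl_def word_refls_append count_list_map_conj)

lemma word_refls_alternating: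
  assumes "s \<in> S" "t \<in> S"
  shows "word_refls (concat (replicate k [s, t])) = map (\<lambda>j. (s \<otimes> t) [^] j \<otimes> s) [0..<2 * k]"
proof (induction k)
  case (Suc k)
  let ?c = "s \<otimes> t"
  have c: "?c \<in> carrier W" using assms by simp
  have inv_c: "inv ?c = t \<otimes> s" using assms by (simp add: inv_mult_group)
  have shift: "s \<otimes> (t \<otimes> (?c [^] j \<otimes> s) \<otimes> t) \<otimes> s = ?c [^] (j + 2) \<otimes> s" for j :: nat
  proof -
    have "s \<otimes> (t \<otimes> (?c [^] j \<otimes> s) \<otimes> t) \<otimes> s = (?c \<otimes> ?c [^] j) \<otimes> (?c \<otimes> s)"
      using assms c by (simp add: m_assoc)
    also have "\<dots> = (?c \<otimes> ?c [^] j \<otimes> ?c) \<otimes> s" using assms c by (simp add: m_assoc)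
    also have "?c \<otimes> ?c [^] j \<otimes> ?c = ?c [^] (j + 2)"
      using c by (metis add_2_eq_Suc' nat_pow_Suc nat_pow_Suc2)
    finally show ?thesis .
  qed
  have "[0..<2 * Suc k] = 0 # 1 # map (\<lambda>j. j + 2) [0..<2 * k]"
    using map_add_upt[of 2 "2 * k"] by (simp add: upt_conv_Cons numeral_2_eq_2 del: upt_Suc)
  then show ?case
    using Suc assms shift by (simp add: nat_pow_Suc2 m_assoc del: upt_Suc)
qed simp

text \<open>The attached reflections are \<open>(st)^j s\<close> for \<open>j < 2m\<close>; since
  \<open>(st)^m = 1\<close>, the list repeats after \<open>m\<close> entries. For infinite order the
  relator is the empty word.\<close>

lemma odd_refl_relator:
  assumes "s \<in> S" "t \<in> S"
  shows "\<not> odd_refl (concat (replicate (ord (s \<otimes> t)) [s, t])) r"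
proof -
  let ?c = "s \<otimes> t" and ?f = "\<lambda>j::nat. (s \<otimes> t) [^] j \<otimes> s" and ?m = "ord (s \<otimes> t)"
  have c: "?c \<in> carrier W" using assms by simp
  have "?f (j + ?m) = ?f j" for j
    using c by (simp flip: nat_pow_mult)
  then have "map ?f [?m..<?m + ?m] = map ?f [0..<?m]"
    by (simp flip: map_add_upt)
  then have "map ?f [0..<2 * ?m] = map ?f [0..<?m] @ map ?f [0..<?m]"
    using upt_add_eq_append[of 0 ?m ?m] by (simp add: mult_2 del: upt_Suc)
  then have "word_refls (concat (replicate ?m [s, t])) = map ?f [0..<?m] @ map ?f [0..<?m]"
    using word_refls_alternating[OF assms] by simp
  then show ?thesis by (simp add: odd_refl_def)
qed

lemma wprod_alternating: "s \<in> S \<Longrightarrow> t \<in> S \<Longrightarrow> wprod (concat (replicate k [s, t])) = (s \<otimes> t) [^] k"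
proof (induction k)
  case (Suc k)
  then have "wprod (concat (replicate (Suc k) [s, t])) = (s \<otimes> t) \<otimes> (s \<otimes> t) [^] k"
    by (simp add: m_assoc)
  then show ?case using Suc.prems by (simp only: nat_pow_Suc2 m_closed gen_carrier)
qed simp

lemma coxeter_equiv_invariants:
  assumes "coxeter_equiv W S us vs"
  shows "set us \<subseteq> S \<and> set vs \<subseteq> S \<and> wprod us = wprod vs \<and>
    (\<forall>r\<in>carrier W. odd_refl us r = odd_refl vs r)"
  using assms
proof induction
  case (rel s t us vs)
  let ?r = "concat (replicate (ord (s \<otimes> t)) [s, t])"
  have r: "set ?r \<subseteq> S" using rel by auto
  have 1: "wprod ?r = \<one>" using rel by (simp add: wprod_alternating)
  show ?case
    using rel r 1 odd_refl_relator[of s t]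
    by (simp add: wprod_append odd_refl_append)
qed auto

text \<open>The presentation of \<open>W\<close> enters here and nowhere else; exchange and lifting
  descend from it.\<close>

lemma odd_refl_cong:
  assumes "set us \<subseteq> S" "set vs \<subseteq> S" "wprod us = wprod vs" "r \<in> carrier W"
  shows "odd_refl us r = odd_refl vs r"
  using coxeter_equiv_invariants[OF presentation[OF assms(1-3)]] assms(4) by blast

text \<open>Strong exchange: the reflection \<open>s_1 ... s_i ... s_1\<close> cancels the letter
  \<open>s_i\<close>, so the witness is the word with that letter deleted.\<close>

lemma word_refls_delete:
  assumes "set ws \<subseteq> S" "t \<in> set (word_refls ws)"
  shows "\<exists>ws'. set ws' \<subseteq> S \<and> length ws' < length ws \<and> wprod ws' = t \<otimes> wprod ws"
  using assms
proof (induction ws arbitrary: t)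
  case (Cons s ws)
  show ?case
  proof (cases "t = s")
    case True
    then show ?thesis using Cons.prems by (intro exI[of _ ws]) simp
  next
    case False
    then obtain r where r: "r \<in> set (word_refls ws)" "t = s \<otimes> r \<otimes> s" using Cons.prems by auto
    then obtain ws' where "set ws' \<subseteq> S" "length ws' < length ws" "wprod ws' = r \<otimes> wprod ws"
      using Cons by force
    moreover have "r \<in> carrier W" using r word_refls_carrier[of ws] Cons.prems by auto
    ultimately show ?thesis
      using r Cons.prems by (intro exI[of _ "s # ws'"]) (auto simp: m_assoc)
  qed
qed simp

lemma odd_refl_imp_mem: "odd_refl ws t \<Longrightarrow> t \<in> set (word_refls ws)"
  unfolding odd_refl_def by (metis count_notin even_zero)

lemma odd_refl_self:
  assumes "set ws \<subseteq> S" "wprod ws \<in> refls"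
  shows "odd_refl ws (wprod ws)"
proof -
  let ?t = "wprod ws"
  obtain x s where x: "x \<in> carrier W" "s \<in> S" "?t = x \<otimes> s \<otimes> inv x" using assms(2) by (rule reflsE)
  obtain xs where xs: "set xs \<subseteq> S" "wprod xs = x" using word_exists x by blast
  obtain ys where ys: "set ys \<subseteq> S" "wprod ys = inv x" using word_exists[of "inv x"] x by auto
  have s: "inv x \<otimes> ?t \<otimes> x = s" using x by (simp add: m_assoc)
  have "odd_refl ws ?t = odd_refl (xs @ [s] @ ys) ?t"
    by (rule odd_refl_cong) (use assms xs ys x in \<open>auto simp: wprod_append m_assoc\<close>)
  also have "\<dots> = (odd_refl xs ?t \<noteq> (odd_refl [s] s \<noteq> odd_refl ys (s \<otimes> s \<otimes> s)))"
    using assms x xs ys s odd_refl_append[of xs "[s] @ ys" ?t] odd_refl_append[of "[s]" ys s] by simp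
  finally have 1: "odd_refl ws ?t = (odd_refl xs ?t \<noteq> (\<not> odd_refl ys s))"
    using x by (simp add: odd_refl_def)
  \<comment> \<open>The word \<open>xs @ ys\<close> represents the identity, so the contributions of
    \<open>xs\<close> and \<open>ys\<close> cancel and only the middle letter \<open>s\<close> is
    left.\<close>
  have "odd_refl (xs @ ys) ?t = odd_refl [] ?t"
    by (rule odd_refl_cong) (use assms xs ys x in \<open>auto simp: wprod_append\<close>)
  then have "odd_refl xs ?t = odd_refl ys s"
    using odd_refl_append[of xs ys ?t] assms xs ys s by (simp add: odd_refl_def)
  with 1 show ?thesis by blast
qed

lemma odd_refl_iff:
  assumes "set ws \<subseteq> S" "t \<in> refls"
  shows "odd_refl ws t \<longleftrightarrow> len (t \<otimes> wprod ws) < len (wprod ws)"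
proof -
  have *: "len (t \<otimes> wprod ws) < len (wprod ws)" if ws: "set ws \<subseteq> S" "odd_refl ws t" for ws
  proof -
    obtain vs where vs: "set vs \<subseteq> S" "wprod vs = wprod ws" "length vs = len (wprod ws)"
      using reduced_word_exists[of "wprod ws"] ws by auto
    then have "odd_refl vs t" using ws assms odd_refl_cong[of vs ws t] by simp
    from word_refls_delete[OF vs(1) odd_refl_imp_mem[OF this]] vs len_le show ?thesis by fastforce
  qed
  \<comment> \<open>Prepending a word for \<open>t\<close> flips the parity at \<open>t\<close>;
    hence \<open>t\<close> shortens \<open>t w\<close>, which says that \<open>w\<close> is the
    shorter one.\<close>
  moreover have "\<not> len (t \<otimes> wprod ws) < len (wprod ws)" if "\<not> odd_refl ws t"
  proof -
    obtain ts where ts: "set ts \<subseteq> S" "wprod ts = t"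
      using word_exists[OF refl_carrier[OF assms(2)]] by blast
    have "odd_refl (ts @ ws) t"
      using that ts assms odd_refl_append[of ts ws t] odd_refl_self[of ts] by simp
    from *[OF _ this] show ?thesis
      using ts assms by (simp add: wprod_append flip: m_assoc)
  qed
  ultimately show ?thesis using assms by blast
qed

lemma len_refl_neq:
  assumes "t \<in> refls" "w \<in> carrier W"
  shows "len (t \<otimes> w) \<noteq> len w"
proof -
  obtain ws ts where ws: "set ws \<subseteq> S" "wprod ws = w" "set ts \<subseteq> S" "wprod ts = t"
    using word_exists assms by (metis refl_carrier)
  have "odd_refl (ts @ ws) t \<noteq> odd_refl ws t"
    using ws assms odd_refl_append[of ts ws t] odd_refl_self[of ts] by simp
  then show ?thesis using odd_refl_iff[of ws t] odd_refl_iff[of "ts @ ws" t] ws assms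
    by (auto simp: wprod_append simp flip: m_assoc)
qed

text \<open>The cocycle rule freed from words. Later arguments share one pattern: a reflection
  shortening \<open>u v\<close> shortens \<open>u\<close>, or its conjugate shortens
  \<open>v\<close>, but not both.\<close>

lemma len_cocycle:
  assumes "t \<in> refls" "u \<in> carrier W" "v \<in> carrier W"
  shows "len (t \<otimes> (u \<otimes> v)) < len (u \<otimes> v) \<longleftrightarrow>
    (len (t \<otimes> u) < len u) \<noteq> (len (inv u \<otimes> t \<otimes> u \<otimes> v) < len v)"
proof -
  obtain us vs where ws: "set us \<subseteq> S" "wprod us = u" "set vs \<subseteq> S" "wprod vs = v"
    using word_exists assms by metis
  then show ?thesis
    using odd_refl_append[of us vs t] assms odd_refl_iff[of "us @ vs" t] odd_refl_iff[of us t]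
      odd_refl_iff[of vs "inv u \<otimes> t \<otimes> u"] refl_conj'[of t u]
    by (simp add: wprod_append)
qed

lemma refl_descent_gen:
  assumes "s \<in> S" "t \<in> refls" "len (t \<otimes> s) < len s"
  shows "t = s"
proof -
  have "t \<otimes> s = \<one>" using assms len_eq_0[of "t \<otimes> s"] by simp
  then show ?thesis using assms by (metis gen_carrier gen_inv inv_equality refl_carrier)
qed

text \<open>For a word of \<open>v\<close> over \<open>I\<close>, all attached reflections lie in
  \<open>W_I\<close>, and by strong exchange \<open>t\<close> is one of them.\<close>

lemma refl_descent_par:
  assumes "I \<subseteq> S" "v \<in> par I" "t \<in> refls" "len (t \<otimes> v) < len v"
  shows "t \<in> par I"
proof -
  obtain vs where vs: "set vs \<subseteq> I" "wprod vs = v" using par_word assms by blast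
  then have "odd_refl vs t" using odd_refl_iff[of vs t] assms by auto
  then show ?thesis using odd_refl_imp_mem word_refls_closed[of I vs] vs assms by blast
qed

section \<open>Bruhat order\<close>

abbreviation le :: "'a \<Rightarrow> 'a \<Rightarrow> bool" where "le \<equiv> bruhat_le W S"

definition below :: "'a \<Rightarrow> 'a set" where "below y = {x. le x y}"

lemma in_below [simp]: "x \<in> below y \<longleftrightarrow> le x y"
  by (simp add: below_def)

lemma le_carrier: "le x y \<Longrightarrow> x \<in> carrier W \<and> y \<in> carrier W"
  by (induction rule: bruhat_le.induct) auto

lemma below_carrier: "below y \<subseteq> carrier W"
  using le_carrier by auto

lemma le_refl [simp]: "x \<in> carrier W \<Longrightarrow> le x x"
  by (rule bruhat_le.refl)

lemma le_trans: "le y z \<Longrightarrow> le x y \<Longrightarrow> le x z"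
  by (induction rule: bruhat_le.induct) (auto intro: bruhat_le.step)

lemma le_step: "y \<in> carrier W \<Longrightarrow> t \<in> refls \<Longrightarrow> len y < len (y \<otimes> t) \<Longrightarrow> le y (y \<otimes> t)"
  by (rule bruhat_le.step) auto

lemma le_len: "le x y \<Longrightarrow> len x \<le> len y \<and> (len x = len y \<longrightarrow> x = y)"
  by (induction rule: bruhat_le.induct) auto

lemma le_antisym: "le x y \<Longrightarrow> le y x \<Longrightarrow> x = y"
  using le_len by (meson order_antisym)

lemma below_mono: "below x \<subseteq> below y \<longleftrightarrow> le x y" if "x \<in> carrier W"
proof
  assume "below x \<subseteq> below y"
  moreover have "x \<in> below x" using that by simp
  ultimately show "le x y" by auto
qed (auto intro: le_trans)

lemma below_inject: "x \<in> carrier W \<Longrightarrow> y \<in> carrier W \<Longrightarrow> below x = below y \<Longrightarrow> x = y"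
  using below_mono[of x y] below_mono[of y x] le_antisym by simp

text \<open>The order is defined by right multiplication with reflections;
  \<open>(y t)^-1 = y^-1 (y t y^-1)\<close> shows that the side does not matter.\<close>

lemma le_inv:
  assumes "le x y" shows "le (inv x) (inv y)"
  using assms
proof induction
  case (step x y t)
  have y: "y \<in> carrier W" using step le_carrier by blast
  have "inv t = t" using step by (simp add: inv_equality)
  then have "inv (y \<otimes> t) = inv y \<otimes> (y \<otimes> t \<otimes> inv y)"
    using step y by (simp add: inv_mult_group m_assoc[symmetric])
  moreover have "len (inv (y \<otimes> t)) = len (y \<otimes> t)" "len (inv y) = len y"
    using step y by simp_all
  ultimately show ?case using step y refl_conj[of t y]
      bruhat_le.step[of W S "inv x" "inv y" "y \<otimes> t \<otimes> inv y"] by simp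
qed simp

lemma len_gen_neq: "s \<in> S \<Longrightarrow> w \<in> carrier W \<Longrightarrow> len (s \<otimes> w) \<noteq> len w"
  using len_refl_neq by simp

lemma len_right_gen: "s \<in> S \<Longrightarrow> w \<in> carrier W \<Longrightarrow> len (w \<otimes> s) = len (s \<otimes> inv w)"
  using len_inv[of "w \<otimes> s"] by (simp del: len_inv add: inv_mult_group)

lemma len_right_gen_neq:
  assumes "s \<in> S" "w \<in> carrier W"
  shows "len (w \<otimes> s) \<noteq> len w"
  using len_gen_neq[of s "inv w"] len_right_gen[of s w] assms by simp

lemma le_gen_mult:
  assumes "s \<in> S" "w \<in> carrier W" "len w < len (s \<otimes> w)"
  shows "le w (s \<otimes> w)"
proof -
  have "w \<otimes> (inv w \<otimes> s \<otimes> w) = s \<otimes> w" using assms by (simp flip: m_assoc)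
  then show ?thesis using le_step[of w "inv w \<otimes> s \<otimes> w"] refl_conj'[of s w] assms by simp
qed

lemma bruhat_less_iff:
  assumes "s \<in> S" "w \<in> carrier W"
  shows "bruhat_less W S w (s \<otimes> w) \<longleftrightarrow> len w < len (s \<otimes> w)"
    and "bruhat_less W S (s \<otimes> w) w \<longleftrightarrow> len (s \<otimes> w) < len w"
  using le_gen_mult[of s w] le_gen_mult[of s "s \<otimes> w"] assms le_len[of w "s \<otimes> w"] le_len[of "s \<otimes> w" w]
    len_gen_neq[of s w]
  unfolding bruhat_less_def by (auto simp: order_less_le)

text \<open>Put \<open>t' = y t y^-1\<close>. If multiplication by \<open>s\<close> destroys the
  ascent from \<open>y\<close> to \<open>t' y\<close>, the cocycle rule for the product of
  \<open>s\<close> and \<open>y\<close> makes \<open>s t' s\<close> a left descent of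
  \<open>s\<close>, and the only such reflection is \<open>s\<close> itself.\<close>

lemma gen_mult_step:
  assumes "s \<in> S" "y \<in> carrier W" "t \<in> refls" "len y < len (y \<otimes> t)"
    "\<not> len (s \<otimes> y) < len (s \<otimes> y \<otimes> t)"
  shows "y \<otimes> t = s \<otimes> y"
proof -
  define t' where "t' = y \<otimes> t \<otimes> inv y"
  define r where "r = s \<otimes> t' \<otimes> s"
  have t': "t' \<in> refls" unfolding t'_def using refl_conj assms by blast
  then have r: "r \<in> refls" unfolding r_def using refl_conj[of t' s] assms by simp
  have 1: "y \<otimes> t = t' \<otimes> y" unfolding t'_def using assms by (simp add: m_assoc)
  have 2: "r \<otimes> (s \<otimes> y) = s \<otimes> y \<otimes> t"
    unfolding r_def using assms t' 1 by (simp add: m_assoc)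
  have 3: "inv s \<otimes> r \<otimes> s = t'" unfolding r_def using assms t' by (simp add: m_assoc)
  have "len (r \<otimes> (s \<otimes> y)) < len (s \<otimes> y)"
    using 2 assms(5) len_refl_neq[OF r, of "s \<otimes> y"] assms by simp
  then have "len (r \<otimes> s) < len s"
    using len_cocycle[OF r, of s y] assms 1 3 by simp
  then have "r = s" using refl_descent_gen r assms by blast
  then have "t' = s" using 3 assms by simp
  then show ?thesis using 1 by simp
qed

text \<open>The usual lifting property, phrased as disjunctions without asking whether
  \<open>s\<close> is a descent of \<open>x\<close> or of \<open>y\<close>. In this form it passes
  along a chain: each step either survives multiplication by \<open>s\<close> or is itself that
  multiplication.\<close>

lemma lifting:
  assumes "le x y" "s \<in> S"
  shows "le (s \<otimes> x) y \<or> le (s \<otimes> x) (s \<otimes> y)"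
    and "le x (s \<otimes> y) \<or> le (s \<otimes> x) (s \<otimes> y)"
proof -
  have "(le (s \<otimes> x) y \<or> le (s \<otimes> x) (s \<otimes> y)) \<and> (le x (s \<otimes> y) \<or> le (s \<otimes> x) (s \<otimes> y))"
    using assms(1)
  proof induction
    case (refl x)
    then show ?case using assms(2) by simp
  next
    case (step x y t)
    have y: "y \<in> carrier W" using step le_carrier by blast
    have 1: "le y (y \<otimes> t)" using step y le_step by blast
    show ?case
    proof (cases "len (s \<otimes> y) < len (s \<otimes> y \<otimes> t)")
      case True
      then have "le (s \<otimes> y) (s \<otimes> (y \<otimes> t))"
        using le_step[of "s \<otimes> y" t] y step assms by (simp add: m_assoc)
      then show ?thesis using step.IH le_trans[OF 1] le_trans[of "s \<otimes> y" "s \<otimes> (y \<otimes> t)"] by blast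
    next
      case False
      then have "y \<otimes> t = s \<otimes> y" using gen_mult_step step y assms by blast
      moreover from this have "le (s \<otimes> x) (y \<otimes> t)" using step.IH le_trans[OF 1] by auto
      ultimately show ?thesis using step.hyps(1) y assms by simp
    qed
  qed
  then show "le (s \<otimes> x) y \<or> le (s \<otimes> x) (s \<otimes> y)" "le x (s \<otimes> y) \<or> le (s \<otimes> x) (s \<otimes> y)" by blast+
qed

section \<open>Lower Bruhat intervals as subsets of the group\<close>

lemma set_mult_iff: "x \<in> A <#> B \<longleftrightarrow> (\<exists>a\<in>A. \<exists>b\<in>B. x = a \<otimes> b)"
  by (auto simp: set_mult_def)

lemma set_mult_one [simp]: "A \<subseteq> carrier W \<Longrightarrow> {\<one>} <#> A = A" "A \<subseteq> carrier W \<Longrightarrow> A <#> {\<one>} = A"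
  by (force simp: set_mult_def)+

lemma gen_pair_idem [simp]: "s \<in> S \<Longrightarrow> {\<one>, s} <#> {\<one>, s} = {\<one>, s}"
  by (auto simp: set_mult_def)

lemma set_mult_finite: "finite A \<Longrightarrow> finite B \<Longrightarrow> finite (A <#> B)"
  by (simp add: set_mult_def)

lemma below_gen_mult:
  assumes "s \<in> S" "w \<in> carrier W" "len w < len (s \<otimes> w)"
  shows "below (s \<otimes> w) = {\<one>, s} <#> below w"
proof (intro equalityI subsetI)
  fix x assume "x \<in> below (s \<otimes> w)"
  then have x: "le x (s \<otimes> w)" "x \<in> carrier W" using le_carrier by auto
  then consider "le x w" | "le (s \<otimes> x) w" using lifting(2)[OF x(1) assms(1)] assms by auto
  then show "x \<in> {\<one>, s} <#> below w"
  proof cases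
    case 1
    then show ?thesis using x unfolding set_mult_iff by force
  next
    case 2
    then show ?thesis using x assms unfolding set_mult_iff
      by (intro bexI[of _ s] bexI[of _ "s \<otimes> x"]) auto
  qed
next
  fix x assume "x \<in> {\<one>, s} <#> below w"
  then obtain y where y: "le y w" "x = \<one> \<otimes> y \<or> x = s \<otimes> y" unfolding set_mult_iff by auto
  have "le w (s \<otimes> w)" using assms le_gen_mult by blast
  then show "x \<in> below (s \<otimes> w)"
    using y lifting(1)[OF y(1) assms(1)] le_trans[OF \<open>le w (s \<otimes> w)\<close>] le_carrier[OF y(1)] by auto
qed

text \<open>Here \<open>w = s (s w)\<close> is an ascent from \<open>s w\<close>, and
  \<open>{1, s}\<close> is idempotent.\<close>

lemma below_gen_descent:
  assumes "s \<in> S" "w \<in> carrier W" "len (s \<otimes> w) < len w"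
  shows "{\<one>, s} <#> below w = below w"
proof -
  have "below w = {\<one>, s} <#> below (s \<otimes> w)" using below_gen_mult[of s "s \<otimes> w"] assms by simp
  moreover have "{\<one>, s} <#> ({\<one>, s} <#> below (s \<otimes> w)) = {\<one>, s} <#> below (s \<otimes> w)"
    using assms below_carrier by (subst set_mult_assoc[symmetric]) auto
  ultimately show ?thesis by simp
qed

lemma below_gen_mult_subset:
  assumes "s \<in> S" "w \<in> carrier W"
  shows "below (s \<otimes> w) \<subseteq> {\<one>, s} <#> below w"
proof (cases "len w < len (s \<otimes> w)")
  case False
  then have "len (s \<otimes> w) < len w" using len_gen_neq[of s w] assms by simp
  then have "below (s \<otimes> w) \<subseteq> below w" "{\<one>, s} <#> below w = below w"
    using below_gen_descent assms below_mono le_gen_mult[of s "s \<otimes> w"] by auto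
  then show ?thesis by simp
qed (use below_gen_mult assms in blast)

text \<open>Suffixes of reduced words are reduced, so every step is an ascent and
  \<open>below_gen_mult\<close> applies to it.\<close>

lemma reduced_induct [consumes 1, case_names one mult]:
  assumes "w \<in> carrier W" and "P \<one>"
    and mult: "\<And>s w. s \<in> S \<Longrightarrow> w \<in> carrier W \<Longrightarrow> len (s \<otimes> w) = Suc (len w) \<Longrightarrow> P w \<Longrightarrow> P (s \<otimes> w)"
  shows "P w"
proof -
  have "set ws \<subseteq> S \<Longrightarrow> length ws = len (wprod ws) \<Longrightarrow> P (wprod ws)" for ws
  proof (induction ws)
    case (Cons s ws)
    have "len (wprod ws) = length ws"
      using Cons.prems len_mult_le[of s "wprod ws"] len_le[of ws] by simp
    then show ?case using Cons mult[of s "wprod ws"] by simp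
  qed (simp add: assms)
  then show ?thesis using reduced_word_exists[OF assms(1)] by metis
qed

lemma below_one [simp]: "below \<one> = {\<one>}"
proof -
  have "x = \<one>" if "le x \<one>" for x
    using le_len[OF that] le_carrier[OF that] by (auto simp: len_eq_0)
  then show ?thesis by auto
qed

lemma finite_below: "w \<in> carrier W \<Longrightarrow> finite (below w)"
  by (induction rule: reduced_induct) (auto simp: below_gen_mult intro!: set_mult_finite)

lemma one_le: "w \<in> carrier W \<Longrightarrow> le \<one> w"
proof (induction rule: reduced_induct)
  case (mult s w)
  then show ?case using le_trans[OF le_gen_mult[of s w]] by simp
qed simp

lemma below_gen: "s \<in> S \<Longrightarrow> below s = {\<one>, s}"
  using below_gen_mult[of s \<one>] by simp

text \<open>Where lengths add, the ordinary product has the lower set of the star product.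
  Additivity for \<open>s u\<close> and \<open>v\<close> forces it for \<open>u\<close> and
  \<open>v\<close>, as a letter adds at most one to the length.\<close>

lemma below_mult:
  assumes "u \<in> carrier W" "v \<in> carrier W" "len (u \<otimes> v) = len u + len v"
  shows "below (u \<otimes> v) = below u <#> below v"
  using assms
proof (induction u rule: reduced_induct)
  case one
  then show ?case using below_carrier by simp
next
  case (mult s u)
  have "len (u \<otimes> v) = len u + len v" "len (s \<otimes> (u \<otimes> v)) = Suc (len (u \<otimes> v))"
    using mult len_mult_le[of u v] len_mult_le[of s "u \<otimes> v"] by (simp_all add: m_assoc)
  then show ?case using mult below_carrier
    by (simp add: m_assoc below_gen_mult set_mult_assoc)
qed

lemma below_par_descents:
  assumes "I \<subseteq> S" "w \<in> carrier W" "\<And>s. s \<in> I \<Longrightarrow> len (s \<otimes> w) < len w"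
  shows "par I <#> below w = below w"
proof (intro equalityI subsetI)
  fix x assume "x \<in> par I <#> below w"
  then obtain a y where a: "a \<in> par I" "le y w" "x = a \<otimes> y" by (auto simp: set_mult_iff)
  have "a \<otimes> y \<in> below w"
    using a(1) assms(1)
  proof (induction a rule: par_induct)
    case (mult s a)
    then have "s \<otimes> (a \<otimes> y) \<in> {\<one>, s} <#> below w" by (auto simp: set_mult_iff)
    then have "s \<otimes> (a \<otimes> y) \<in> below w" using below_gen_descent[of s w] assms mult by blast
    moreover have "a \<in> carrier W" "s \<in> carrier W" "y \<in> carrier W"
      using mult a le_carrier par_closed[OF assms(1)] assms(1) by auto
    ultimately show ?case by (simp add: m_assoc)
  qed (use a le_carrier in simp)
  then show "x \<in> below w" using a by simp
next
  fix x assume "x \<in> below w"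
  then show "x \<in> par I <#> below w"
    using generate.one[of W I] le_carrier by (force simp: set_mult_iff)
qed

text \<open>The mirror image under inversion. Finiteness of \<open>W_I\<close> is not presupposed
  but can be deduced: \<open>W_I\<close> is then contained in the finite set \<open>below w\<close>.
  This is how a new finitary set is found in the construction of reduced expressions.\<close>

lemma below_par_right_descents:
  assumes "I \<subseteq> S" "w \<in> carrier W" "\<And>s. s \<in> I \<Longrightarrow> len (w \<otimes> s) < len w"
  shows "below w <#> par I = below w"
proof -
  have 1: "len (s \<otimes> inv w) < len (inv w)" if "s \<in> I" for s
    using assms(3)[OF that] that assms(1,2) len_right_gen[of s w] by auto
  have 2: "par I <#> below (inv w) = below (inv w)"
    using below_par_descents[OF assms(1) _ 1] assms(2) by blast
  show ?thesis
  proof (intro equalityI subsetI)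
    fix x assume "x \<in> below w <#> par I"
    then obtain a y where a: "a \<in> par I" "le y w" "x = y \<otimes> a" by (auto simp: set_mult_iff)
    have c: "a \<in> carrier W" "y \<in> carrier W" using a par_closed[OF assms(1)] le_carrier by auto
    have "inv x = inv a \<otimes> inv y" using a c by (simp add: inv_mult_group)
    then have "inv x \<in> par I <#> below (inv w)"
      using le_inv a par_subgroup[OF assms(1)] subgroup.m_inv_closed by (force simp: set_mult_iff)
    then have "le (inv x) (inv w)" using 2 by simp
    then show "x \<in> below w" using le_inv[of "inv x" "inv w"] a c assms by simp
  next
    fix x assume "x \<in> below w"
    then show "x \<in> below w <#> par I"
      using generate.one[of W I] le_carrier by (force simp: set_mult_iff)
  qed
qed

text \<open>The words supplied by \<open>par_induct\<close> need not be reduced, hence the inclusion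
  \<open>below_gen_mult_subset\<close>, valid for ascents and descents alike.\<close>

lemma below_par:
  assumes "I \<subseteq> S" "a \<in> par I"
  shows "below a \<subseteq> par I"
  using assms(2,1)
proof (induction a rule: par_induct)
  case one
  then show ?case by (simp add: generate.one)
next
  case (mult s a)
  have "below (s \<otimes> a) \<subseteq> {\<one>, s} <#> below a"
    using below_gen_mult_subset mult assms par_closed by blast
  also have "\<dots> \<subseteq> par I"
    using mult.IH generate.eng[of _ W I] par_gen[OF mult.hyps(1)] generate.one[of W I]
    unfolding set_mult_iff subset_iff by blast
  finally show ?case .
qed

section \<open>The star product\<close>

text \<open>A product of two principal lower sets is principal: reading a reduced word of
  \<open>x\<close> from the right, each letter \<open>s\<close> either replaces the current
  \<open>z\<close> by \<open>s z\<close> or is absorbed.\<close>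

lemma star_value_exists:
  assumes "x \<in> carrier W" "y \<in> carrier W"
  shows "\<exists>z\<in>carrier W. below z = below x <#> below y"
  using assms
proof (induction x rule: reduced_induct)
  case one
  then show ?case using below_carrier by auto
next
  case (mult s x)
  then obtain z where z: "z \<in> carrier W" "below z = below x <#> below y" by blast
  have *: "below (s \<otimes> x) <#> below y = {\<one>, s} <#> below z"
    using mult z below_carrier by (simp add: below_gen_mult set_mult_assoc)
  show ?case
  proof (cases "len z < len (s \<otimes> z)")
    case True
    then show ?thesis using * z mult below_gen_mult[of s z] by (intro bexI[of _ "s \<otimes> z"]) auto
  next
    case False
    then have "len (s \<otimes> z) < len z" using len_gen_neq[of s z] mult z by simp
    then show ?thesis using * z mult below_gen_descent[of s z] by (intro bexI[of _ z]) auto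
  qed
qed

text \<open>Since \<open>star\<close> is defined by choice, its laws are available only once some
  product satisfying them has been exhibited.\<close>

lemma star_product_exists: "\<exists>f. is_star_product W S f"
proof -
  define f where "f = (\<lambda>x y. SOME z. z \<in> carrier W \<and> below z = below x <#> below y)"
  have f: "f x y \<in> carrier W" "below (f x y) = below x <#> below y"
    if "x \<in> carrier W" "y \<in> carrier W" for x y
    using someI_ex[of "\<lambda>z. z \<in> carrier W \<and> below z = below x <#> below y"]
      star_value_exists[OF that] unfolding f_def by blast+
  have eqI: "f x y = z"
    if "x \<in> carrier W" "y \<in> carrier W" "z \<in> carrier W" "below z = below x <#> below y" for x y z
    using f that by (metis below_inject)
  have "f (f x y) z = f x (f y z)"
    if "x \<in> carrier W" "y \<in> carrier W" "z \<in> carrier W" for x y z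
    using that below_carrier by (intro eqI) (simp_all add: f set_mult_assoc)
  moreover have "f \<one> x = x" "f x \<one> = x" if "x \<in> carrier W" for x
    using that below_carrier by (auto intro!: eqI)
  moreover have "f s w = s \<otimes> w" if "s \<in> S" "w \<in> carrier W" "len w < len (s \<otimes> w)" for s w
    using that by (intro eqI) (simp_all add: below_gen below_gen_mult)
  moreover have "f s w = w" if "s \<in> S" "w \<in> carrier W" "len (s \<otimes> w) < len w" for s w
    using that by (intro eqI) (simp_all add: below_gen below_gen_descent)
  ultimately have "is_star_product W S f"
    unfolding is_star_product_def using f(1) by (auto simp: bruhat_less_iff)
  then show ?thesis by blast
qed

lemma star_is_star_product: "is_star_product W S (star W S)"
  unfolding star_def using star_product_exists by (rule someI_ex)

lemma star_closed: "x \<in> carrier W \<Longrightarrow> y \<in> carrier W \<Longrightarrow> star W S x y \<in> carrier W"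
  using star_is_star_product by (simp add: is_star_product_def)

text \<open>The defining conditions prescribe \<open>star\<close> for a generator on the left;
  associativity extends this along a reduced word of \<open>x\<close>.\<close>

lemma below_star:
  assumes "x \<in> carrier W" "y \<in> carrier W"
  shows "below (star W S x y) = below x <#> below y"
  using assms
proof (induction x rule: reduced_induct)
  case one
  then show ?case using star_is_star_product below_carrier by (simp add: is_star_product_def)
next
  case (mult s x)
  note f = star_is_star_product[unfolded is_star_product_def]
  have 1: "star W S s z = (if len z < len (s \<otimes> z) then s \<otimes> z else z)" if "z \<in> carrier W" for z
    using f mult(1) that bruhat_less_iff[OF mult(1) that] len_gen_neq[OF mult(1) that]
    by (metis nat_neq_iff)
  have 2: "below (star W S s z) = {\<one>, s} <#> below z" if "z \<in> carrier W" for z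
    using 1[OF that] mult(1) that len_gen_neq[OF mult(1) that]
    by (simp add: below_gen_mult below_gen_descent)
  have "star W S s (star W S x y) = star W S (star W S s x) y"
    using f mult by (metis gen_carrier)
  also have "star W S s x = s \<otimes> x" using 1[of x] mult by simp
  finally show ?case
    using 2[of "star W S x y"] mult below_carrier star_closed[of x y]
    by (simp add: below_gen_mult set_mult_assoc)
qed

section \<open>Longest elements and double cosets\<close>

text \<open>An element of maximal length in \<open>W_I\<close> has all of \<open>I\<close> as left
  descents, so its lower set absorbs \<open>W_I\<close> and equals it. Injectivity of
  \<open>below\<close> then gives the uniqueness that the description in \<open>longest\<close>
  requires.\<close>

lemma longest_props:
  assumes "finitary W S I"
  shows "longest W S I \<in> par I" and "below (longest W S I) = par I"
    and "\<And>v. v \<in> par I \<Longrightarrow> len v \<le> len (longest W S I)"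
proof -
  have I: "I \<subseteq> S" "finite (par I)" using assms by (auto simp: finitary_def)
  have *: "below w = par I" if w: "w \<in> par I" "\<And>v. v \<in> par I \<Longrightarrow> len v \<le> len w" for w
  proof
    show "below w \<subseteq> par I" using below_par I w by blast
    have wc: "w \<in> carrier W" using par_closed I w by blast
    have "len (s \<otimes> w) < len w" if "s \<in> I" for s
      using w(2)[of "s \<otimes> w"] len_gen_neq[of s w] that I w wc
      by (simp add: generate.eng par_gen le_neq_implies_less subset_iff)
    then have "par I <#> below w = below w" using below_par_descents I wc by blast
    moreover have "a \<in> par I <#> below w" if "a \<in> par I" for a
      using that one_le[OF wc] par_closed[OF I(1)] by (force simp: set_mult_iff)
    ultimately show "par I \<subseteq> below w" by blast
  qed
  have "par I \<noteq> {}" using generate.one by blast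
  then have "Max (len ` par I) \<in> len ` par I" using I by simp
  then obtain w where w: "w \<in> par I" "len w = Max (len ` par I)" by auto
  then have w2: "\<And>v. v \<in> par I \<Longrightarrow> len v \<le> len w" using I by simp
  have "longest W S I = w" unfolding longest_def
  proof (rule the_equality)
    fix v assume v: "v \<in> par I \<and> (\<forall>u\<in>par I. len u \<le> len v)"
    then have "below v = below w" using * w w2 by metis
    then show "v = w" using below_inject v w par_closed[OF I(1)] by blast
  qed (use w w2 in blast)
  then show "longest W S I \<in> par I" "below (longest W S I) = par I"
    "\<And>v. v \<in> par I \<Longrightarrow> len v \<le> len (longest W S I)"
    using w w2 *[OF w(1) w2] by auto
qed

lemma finitary_par: "finitary W S I \<Longrightarrow> I \<subseteq> S" "finitary W S I \<Longrightarrow> finite (par I)"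
  by (auto simp: finitary_def)

lemma longest_carrier: "finitary W S I \<Longrightarrow> longest W S I \<in> carrier W"
  using longest_props(1) par_closed finitary_par by blast

lemma longest_eqI:
  assumes "finitary W S I" "a \<in> par I" "len (longest W S I) \<le> len a"
  shows "a = longest W S I"
  using le_len[of a "longest W S I"] assms longest_props[OF assms(1)]
  by (metis in_below order_antisym)

section \<open>Greatest and least elements of double cosets\<close>

lemma double_cosets_iff:
  "p \<in> double_cosets W I J \<longleftrightarrow>
    (\<exists>x\<in>carrier W. p = {a \<otimes> x \<otimes> c |a c. a \<in> par I \<and> c \<in> par J})"
  unfolding double_cosets_def r_coset_def set_mult_def by blast

lemma double_coset_mult:
  assumes "I \<subseteq> S" "J \<subseteq> S" "p \<in> double_cosets W I J" "x \<in> p" "a \<in> par I" "c \<in> par J"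
  shows "a \<otimes> x \<otimes> c \<in> p"
proof -
  obtain z where z: "z \<in> carrier W" "p = {a \<otimes> z \<otimes> c |a c. a \<in> par I \<and> c \<in> par J}"
    using assms(3) double_cosets_iff by blast
  then obtain a' c' where a': "a' \<in> par I" "c' \<in> par J" "x = a' \<otimes> z \<otimes> c'" using assms by blast
  have "a \<otimes> x \<otimes> c = (a \<otimes> a') \<otimes> z \<otimes> (c' \<otimes> c)"
    using assms a' z par_closed[OF assms(1)] par_closed[OF assms(2)] by (simp add: m_assoc subset_iff)
  then show ?thesis using z(2) generate.eng[OF assms(5) a'(1)] generate.eng[OF a'(2) assms(6)] by blast
qed

lemma double_coset_connected:
  assumes "I \<subseteq> S" "J \<subseteq> S" "p \<in> double_cosets W I J" "x \<in> p" "y \<in> p"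
  shows "\<exists>a\<in>par I. \<exists>c\<in>par J. y = a \<otimes> x \<otimes> c"
proof -
  obtain z where z: "z \<in> carrier W" "p = {a \<otimes> z \<otimes> c |a c. a \<in> par I \<and> c \<in> par J}"
    using assms(3) double_cosets_iff by blast
  then obtain a c a' c' where
    a: "a \<in> par I" "c \<in> par J" "x = a \<otimes> z \<otimes> c" and
    a': "a' \<in> par I" "c' \<in> par J" "y = a' \<otimes> z \<otimes> c'" using assms by blast
  have c: "a \<in> carrier W" "a' \<in> carrier W" "c \<in> carrier W" "c' \<in> carrier W"
    using a a' par_closed assms by auto
  have "inv a \<otimes> (a \<otimes> z \<otimes> c) \<otimes> inv c = z" using c z by (simp add: m_assoc)
  then have "y = a' \<otimes> (inv a \<otimes> x \<otimes> inv c) \<otimes> c'" using a a' by simp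
  then have "y = (a' \<otimes> inv a) \<otimes> x \<otimes> (inv c \<otimes> c')"
    using c z(1) a(3) by (simp add: m_assoc)
  moreover have "a' \<otimes> inv a \<in> par I" "inv c \<otimes> c' \<in> par J"
    using a a' par_subgroup assms(1,2) by (auto intro: generate.eng subgroup.m_inv_closed)
  ultimately show ?thesis by blast
qed

lemma double_coset_self:
  assumes "x \<in> carrier W"
  shows "\<exists>p\<in>double_cosets W I J. x \<in> p"
proof
  let ?p = "{a \<otimes> x \<otimes> c |a c. a \<in> par I \<and> c \<in> par J}"
  show "?p \<in> double_cosets W I J" using assms double_cosets_iff by blast
  show "x \<in> ?p" using assms generate.one[of W I] generate.one[of W J] by force
qed

lemma double_coset_carrier:
  assumes "I \<subseteq> S" "J \<subseteq> S" "p \<in> double_cosets W I J"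
  shows "p \<subseteq> carrier W"
  using assms par_closed[of I] par_closed[of J] unfolding double_cosets_iff by blast

lemma double_coset_nonempty: "p \<in> double_cosets W I J \<Longrightarrow> p \<noteq> {}"
  unfolding double_cosets_iff using generate.one[of W] by blast

lemma double_coset_finite:
  assumes "finitary W S I" "finitary W S J" "p \<in> double_cosets W I J"
  shows "finite p"
proof -
  obtain x where "p = {a \<otimes> x \<otimes> c |a c. a \<in> par I \<and> c \<in> par J}"
    using assms(3) unfolding double_cosets_iff by blast
  then have "p = (\<lambda>(a, c). a \<otimes> x \<otimes> c) ` (par I \<times> par J)" by auto
  then show ?thesis using finitary_par(2)[OF assms(1)] finitary_par(2)[OF assms(2)] by simp
qed

lemma below_double_star:
  assumes "finitary W S I" "finitary W S J" "x \<in> carrier W"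
  shows "\<exists>z\<in>carrier W. below z = par I <#> below x <#> par J"
  using assms
  by (intro bexI[of _ "star W S (star W S (longest W S I) x) (longest W S J)"])
    (simp_all add: below_star star_closed longest_carrier longest_props)

text \<open>A longest element \<open>m\<close> has every element of \<open>I\<close> as a left
  descent and every element of \<open>J\<close> as a right descent, so \<open>below m\<close>
  absorbs both parabolics and contains the coset.\<close>

lemma coset_max_props:
  assumes I: "finitary W S I" and J: "finitary W S J" and p: "p \<in> double_cosets W I J"
  shows "coset_max W S p \<in> p" and "\<And>y. y \<in> p \<Longrightarrow> le y (coset_max W S p)"
    and "\<And>x. x \<in> p \<Longrightarrow> below (coset_max W S p) = par I <#> below x <#> par J"
proof -
  note IS = finitary_par(1)[OF I] and JS = finitary_par(1)[OF J]
  note pc = double_coset_carrier[OF IS JS p]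
  have "Max (len ` p) \<in> len ` p" 
    using double_coset_finite[OF I J p] double_coset_nonempty[OF p] by simp
  then obtain m where m: "m \<in> p" "len m = Max (len ` p)" by auto
  then have max: "len y \<le> len m" if "y \<in> p" for y
    using that double_coset_finite[OF I J p] by simp
  have mc: "m \<in> carrier W" using m pc by blast
  have "len (s \<otimes> m) < len m" if "s \<in> I" for s
    using double_coset_mult[OF IS JS p m(1) par_gen[OF that] generate.one] max[of "s \<otimes> m"]
      len_gen_neq[of s m] that IS mc by (simp add: le_neq_implies_less subset_iff)
  then have L: "par I <#> below m = below m" using below_par_descents IS mc by blast
  have "len (m \<otimes> s) < len m" if "s \<in> J" for s
    using double_coset_mult[OF IS JS p m(1) generate.one par_gen[OF that]] max[of "m \<otimes> s"]
      len_right_gen_neq[of s m] that JS mc by (simp add: le_neq_implies_less subset_iff)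
  then have R: "below m <#> par J = below m" using below_par_right_descents JS mc by blast
  have ub: "le y m" if y: "y \<in> p" for y
  proof -
    obtain a c where a: "a \<in> par I" "c \<in> par J" "y = a \<otimes> m \<otimes> c"
      using double_coset_connected[OF IS JS p m(1) y] by blast
    then have "y \<in> par I <#> below m <#> par J" using mc by (force simp: set_mult_iff)
    then show ?thesis using L R by simp
  qed
  have eq: "coset_max W S p = m" unfolding coset_max_def
    by (rule the_equality) (use m ub le_antisym in blast)+
  then show "coset_max W S p \<in> p" "\<And>y. y \<in> p \<Longrightarrow> le y (coset_max W S p)" using m ub by auto
  fix x assume x: "x \<in> p"
  \<comment> \<open>The product is itself a lower set \<open>below z\<close>, so that containing
    \<open>m\<close> it contains all of \<open>below m\<close>.\<close>
  obtain z where z: "z \<in> carrier W" "below z = par I <#> below x <#> par J"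
    using below_double_star[OF I J] x pc by blast
  obtain a c where "a \<in> par I" "c \<in> par J" "m = a \<otimes> x \<otimes> c"
    using double_coset_connected[OF IS JS p x m(1)] by blast
  then have "m \<in> below z" unfolding z(2) using x pc by (force simp: set_mult_iff)
  then have "below m \<subseteq> below z" using mc below_mono by simp
  moreover have "below x \<subseteq> below m" using below_mono ub x pc by blast
  then have "par I <#> below x <#> par J \<subseteq> par I <#> below m <#> par J"
    by (intro mono_set_mult) auto
  ultimately show "below (coset_max W S p) = par I <#> below x <#> par J"
    using z(2) L R eq by simp
qed

text \<open>Letters of \<open>a\<close> are removed one at a time: by lifting, \<open>x\<close>
  below \<open>s z'\<close> gives \<open>x\<close> or \<open>s x\<close> below \<open>z'\<close>,
  and \<open>x\<close> lies below \<open>s x\<close>.\<close>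

lemma le_par_cancel:
  assumes "I \<subseteq> S" "a \<in> par I" "z \<in> carrier W" "le x (a \<otimes> z)"
    "\<And>s. s \<in> I \<Longrightarrow> le x (s \<otimes> x)"
  shows "le x z"
  using assms(2,1,4)
proof (induction a rule: par_induct)
  case (mult s a)
  have c: "a \<in> carrier W" "s \<in> S" using mult assms(1) par_closed by auto
  have "le x (s \<otimes> (a \<otimes> z))" using mult.prems c assms(3) by (simp add: m_assoc)
  from lifting(2)[OF this c(2)] have "le x (a \<otimes> z) \<or> le (s \<otimes> x) (a \<otimes> z)"
    using c assms(3) by simp
  then show ?case using mult assms(5) le_trans by blast
qed (use assms in simp)

lemma le_par_cancel_right:
  assumes "J \<subseteq> S" "c \<in> par J" "z \<in> carrier W" "le x (z \<otimes> c)"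
    "\<And>s. s \<in> J \<Longrightarrow> le x (x \<otimes> s)"
  shows "le x z"
proof -
  have c: "c \<in> carrier W" using assms par_closed by blast
  have x: "x \<in> carrier W" using assms le_carrier by blast
  have "le (inv x) (s \<otimes> inv x)" if "s \<in> J" for s
    using le_inv[OF assms(5)[OF that]] x that assms(1) by (auto simp: inv_mult_group)
  moreover have "le (inv x) (inv c \<otimes> inv z)"
    using le_inv[OF assms(4)] c assms(3) by (simp add: inv_mult_group)
  moreover have "inv c \<in> par J" using assms par_subgroup subgroup.m_inv_closed by metis
  ultimately have "le (inv x) (inv z)"
    using le_par_cancel[of J "inv c" "inv z" "inv x"] assms by simp
  then show ?thesis using le_inv[of "inv x" "inv z"] x assms by simp
qed

lemma coset_min_props:
  assumes IS: "I \<subseteq> S" and JS: "J \<subseteq> S" and p: "p \<in> double_cosets W I J"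
  shows "coset_min W S p \<in> p" and "\<And>y. y \<in> p \<Longrightarrow> le (coset_min W S p) y"
    and "\<And>s. s \<in> I \<Longrightarrow> le (coset_min W S p) (s \<otimes> coset_min W S p)"
    and "\<And>s. s \<in> J \<Longrightarrow> le (coset_min W S p) (coset_min W S p \<otimes> s)"
proof -
  note pc = double_coset_carrier[OF IS JS p]
  obtain y where "y \<in> p" using double_coset_nonempty[OF p] by blast
  from ex_has_least_nat[of "\<lambda>x. x \<in> p" y len, OF this]
  obtain x where x: "x \<in> p" "\<And>y. y \<in> p \<Longrightarrow> len x \<le> len y" by blast
  have xc: "x \<in> carrier W" using x pc by blast
  have lI: "le x (s \<otimes> x)" if "s \<in> I" for s
    using double_coset_mult[OF IS JS p x(1) par_gen[OF that] generate.one] x(2)[of "s \<otimes> x"]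
      len_gen_neq[of s x] that IS xc by (intro le_gen_mult) (auto simp: le_neq_implies_less subset_iff)
  have "le (inv x) (s \<otimes> inv x)" if "s \<in> J" for s
    using double_coset_mult[OF IS JS p x(1) generate.one par_gen[OF that]] x(2)[of "x \<otimes> s"]
      len_right_gen_neq[of s x] that JS xc len_right_gen[of s x]
    by (intro le_gen_mult) (auto simp: le_neq_implies_less subset_iff)
  from le_inv[OF this] have lJ: "le x (x \<otimes> s)" if "s \<in> J" for s
    using that JS xc by (simp add: inv_mult_group subset_iff)
  \<comment> \<open>Write \<open>x = a y c\<close>; cancelling \<open>c\<close> and then
    \<open>a\<close> from the trivial relation of \<open>x\<close> to itself leaves \<open>x\<close>
    below \<open>y\<close>.\<close>
  have lb: "le x y" if y: "y \<in> p" for y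
  proof -
    obtain a c where a: "a \<in> par I" "c \<in> par J" "x = a \<otimes> y \<otimes> c"
      using double_coset_connected[OF IS JS p y x(1)] by blast
    have "a \<in> carrier W" "c \<in> carrier W" "y \<in> carrier W"
      using a par_closed IS JS y pc by auto
    then show ?thesis
      using le_par_cancel_right[OF JS a(2), of "a \<otimes> y" x] le_par_cancel[OF IS a(1), of y x] lI lJ a xc
      by (metis le_refl m_closed)
  qed
  have eq: "coset_min W S p = x" unfolding coset_min_def
    by (rule the_equality) (use x lb le_antisym in blast)+
  then show "coset_min W S p \<in> p" "\<And>y. y \<in> p \<Longrightarrow> le (coset_min W S p) y"
    "\<And>s. s \<in> I \<Longrightarrow> le (coset_min W S p) (s \<otimes> coset_min W S p)"
    "\<And>s. s \<in> J \<Longrightarrow> le (coset_min W S p) (coset_min W S p \<otimes> s)"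
    using x lb lI lJ by auto
qed

text \<open>Downwards, the parabolic factors in \<open>max q = a (min q) c\<close> are cancelled
  against the minimality of \<open>min p\<close>. Upwards, \<open>B(max) = W_I B(min) W_J\<close> is
  monotone in \<open>B(min)\<close>.\<close>

lemma coset_max_le_iff_coset_min_le:
  assumes I: "finitary W S I" and J: "finitary W S J"
    and p: "p \<in> double_cosets W I J" and q: "q \<in> double_cosets W I J"
  shows "le (coset_max W S p) (coset_max W S q) \<longleftrightarrow> le (coset_min W S p) (coset_min W S q)"
proof -
  note IS = finitary_par(1)[OF I] and JS = finitary_par(1)[OF J]
  note maxp = coset_max_props[OF I J p] and maxq = coset_max_props[OF I J q]
  note minp = coset_min_props[OF IS JS p] and minq = coset_min_props[OF IS JS q]
  note c = double_coset_carrier[OF IS JS p] double_coset_carrier[OF IS JS q]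
  show ?thesis
  proof
    assume le: "le (coset_max W S p) (coset_max W S q)"
    obtain a c where a: "a \<in> par I" "c \<in> par J"
      "coset_max W S q = a \<otimes> coset_min W S q \<otimes> c"
      using double_coset_connected[OF IS JS q minq(1) maxq(1)] by blast
    have mc: "coset_min W S q \<in> carrier W" using minq(1) c by blast
    have "le (coset_min W S p) (a \<otimes> coset_min W S q \<otimes> c)"
      using le maxp(2)[OF minp(1)] le_trans a(3) by metis
    moreover have "a \<in> carrier W" using a par_closed IS by blast
    ultimately show "le (coset_min W S p) (coset_min W S q)"
      using le_par_cancel_right[OF JS a(2)] le_par_cancel[OF IS a(1) mc] minp(3,4) mc by simp
  next
    assume "le (coset_min W S p) (coset_min W S q)"
    then have "below (coset_min W S p) \<subseteq> below (coset_min W S q)"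
      using below_mono le_carrier by blast
    then have "below (coset_max W S p) \<subseteq> below (coset_max W S q)"
      unfolding maxp(3)[OF minp(1)] maxq(3)[OF minq(1)] by (intro mono_set_mult) auto
    then show "le (coset_max W S p) (coset_max W S q)"
      using below_mono maxp(1) c by blast
  qed
qed

section \<open>Paths\<close>

definition gen_prod :: "'a set list \<Rightarrow> 'a set" where
  "gen_prod Is = foldr (\<lambda>K A. par K <#> A) Is {\<one>}"

lemma gen_prod_simps [simp]: "gen_prod [] = {\<one>}" "gen_prod (K # Is) = par K <#> gen_prod Is"
  by (simp_all add: gen_prod_def)

lemma gen_prod_carrier: "\<forall>K\<in>set Is. K \<subseteq> S \<Longrightarrow> gen_prod Is \<subseteq> carrier W"
  by (induction Is) (simp_all add: set_mult_closed par_closed)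

lemma gen_prod_snoc:
  "\<forall>K\<in>set Is. K \<subseteq> S \<Longrightarrow> K \<subseteq> S \<Longrightarrow> gen_prod (Is @ [K]) = gen_prod Is <#> par K"
  by (induction Is) (simp_all add: set_mult_assoc par_closed gen_prod_carrier)

lemma par_absorb:
  assumes "L \<subseteq> K" "K \<subseteq> S"
  shows "par L <#> par K = par K" "par K <#> par L = par K"
proof -
  have LK: "par L \<subseteq> par K" by (rule mono_generate[OF assms(1)])
  have c: "par K \<subseteq> carrier W" using par_closed assms by blast
  have "par L <#> par K \<subseteq> par K" "par K <#> par L \<subseteq> par K"
    using LK unfolding set_mult_def by (auto intro: generate.eng)
  moreover have "x \<in> par L <#> par K" "x \<in> par K <#> par L" if "x \<in> par K" for x
    using that c generate.one[of W L] by (force simp: set_mult_iff)+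
  ultimately show "par L <#> par K = par K" "par K <#> par L = par K" by blast+
qed

text \<open>In particular a descending step leaves the product of parabolics unchanged.\<close>

lemma gen_prod_last:
  assumes "Is \<noteq> []" "\<forall>K\<in>set Is. K \<subseteq> S" "L \<subseteq> last Is"
  shows "gen_prod Is <#> par L = gen_prod Is"
proof -
  obtain xs K where Is: "Is = xs @ [K]" using assms(1) by (metis append_butlast_last_id)
  have c: "K \<subseteq> S" "L \<subseteq> K" "gen_prod xs \<subseteq> carrier W" using assms Is gen_prod_carrier[of xs] by auto
  then have "L \<subseteq> S" by blast
  then have "gen_prod xs <#> par K <#> par L = gen_prod xs <#> (par K <#> par L)"
    using c by (simp add: set_mult_assoc par_closed)
  then show ?thesis using Is assms c by (simp add: par_absorb gen_prod_snoc)
qed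

lemma gen_prod_hd:
  assumes "Is \<noteq> []" "\<forall>K\<in>set Is. K \<subseteq> S"
  shows "par (hd Is) <#> gen_prod Is = gen_prod Is"
proof -
  obtain xs K where Is: "Is = K # xs" using assms(1) by (cases Is) auto
  then show ?thesis
    using assms par_absorb(1)[of K K]
    by (simp add: set_mult_assoc[symmetric] par_closed gen_prod_carrier)
qed

lemma below_star_prod:
  assumes "\<forall>K\<in>set Is. finitary W S K"
  shows "star_prod W S (map (longest W S) Is) \<in> carrier W \<and>
    below (star_prod W S (map (longest W S) Is)) = gen_prod Is"
  using assms
  by (induction Is)
    (simp_all add: star_prod_def star_closed below_star longest_carrier longest_props)

text \<open>The indexed conditions are recast for appending an entry: paths keep the first label
  fixed while the last one varies, so inductions run from the right.\<close>

lemma is_expression_snoc: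
  assumes "Is \<noteq> []"
  shows "is_expression W S (Is @ [K]) \<longleftrightarrow> is_expression W S Is \<and> finitary W S K \<and>
    (\<exists>s\<in>S. (s \<notin> last Is \<and> K = insert s (last Is)) \<or> (s \<in> last Is \<and> K = last Is - {s}))"
proof -
  obtain n where n: "length Is = Suc n" using assms by (cases Is) auto
  have l: "last Is = Is ! n" using assms n by (simp add: last_conv_nth)
  show ?thesis
    using assms unfolding is_expression_def l
    by (simp add: n nth_append less_Suc_eq all_conj_distrib imp_conjR conj_disj_distribR disj_imp)
      (auto simp: n nth_append less_Suc_eq)
qed

lemma is_expression_snoc_cases:
  assumes "Is \<noteq> []" "is_expression W S (Is @ [K])"
  shows "last Is \<subset> K \<or> K \<subset> last Is"
  using assms by (auto simp: is_expression_snoc)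

lemma subordinate_path_snoc:
  assumes "Is \<noteq> []" "length ps = length Is"
  shows "subordinate_path W (Is @ [K]) (ps @ [r]) \<longleftrightarrow> subordinate_path W Is ps \<and>
    r \<in> double_cosets W (hd Is) K \<and>
    (last Is \<subset> K \<longrightarrow> last ps \<subseteq> r) \<and> (K \<subset> last Is \<longrightarrow> r \<subseteq> last ps)"
proof -
  obtain n where n: "length Is = Suc n" using assms by (cases Is) auto
  have "ps \<noteq> []" using assms by auto
  then have l: "last Is = Is ! n" "last ps = ps ! n" "hd Is = Is ! 0"
    using assms n by (simp_all add: last_conv_nth hd_conv_nth)
  have *: "(\<forall>k. Suc k < Suc (Suc n) \<longrightarrow> P k) \<longleftrightarrow> (\<forall>k. Suc k < Suc n \<longrightarrow> P k) \<and> P n" for P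
    by (auto simp: less_Suc_eq)
  have **: "(\<forall>k<Suc (Suc n). P k) \<longleftrightarrow> (\<forall>k<Suc n. P k) \<and> P (Suc n)" for P
    by (auto simp: less_Suc_eq)
  show ?thesis
    unfolding subordinate_path_def l length_append list.size assms(2) n add_Suc_right add_0_right * **
    using assms(2) n by (auto simp: nth_append)
qed

lemma double_coset_subset:
  assumes "I \<subseteq> S" "J \<subseteq> S" "p \<in> double_cosets W I J" "x \<in> p" "x \<in> A"
    "par I <#> A = A" "A <#> par J = A"
  shows "p \<subseteq> A"
proof
  fix y assume "y \<in> p"
  then obtain a c where "a \<in> par I" "c \<in> par J" "y = a \<otimes> x \<otimes> c"
    using double_coset_connected assms by blast
  moreover from this have "a \<otimes> x \<in> par I <#> A" using assms(5) unfolding set_mult_iff by blast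
  ultimately have "y \<in> (par I <#> A) <#> par J" unfolding set_mult_iff[of y] by blast
  then show "y \<in> A" using assms by simp
qed

lemma is_expression_finitary: "is_expression W S Is \<Longrightarrow> \<forall>K\<in>set Is. finitary W S K"
  by (simp add: is_expression_def)

lemma is_expression_subset: "is_expression W S Is \<Longrightarrow> \<forall>K\<in>set Is. K \<subseteq> S"
  by (auto simp: is_expression_def finitary_def)

lemma is_expression_hd_last:
  "is_expression W S Is \<Longrightarrow> finitary W S (hd Is) \<and> finitary W S (last Is)"
  by (simp add: is_expression_def)

lemma double_coset_order_mono:
  assumes "I \<subseteq> S" "K \<subseteq> S" "L \<subseteq> K" "p \<in> double_cosets W I L" "r \<in> double_cosets W I K"
    "x \<in> p" "x \<in> r"
  shows "p \<subseteq> r"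
proof
  fix y assume "y \<in> p"
  then obtain a c where "a \<in> par I" "c \<in> par L" "y = a \<otimes> x \<otimes> c"
    using double_coset_connected[of I L p x y] assms by blast
  then show "y \<in> r"
    using double_coset_mult[of I K r x a c] mono_generate[OF assms(3)] assms by blast
qed

lemma path_terminus_iff:
  assumes "is_expression W S Is" "p \<in> double_cosets W (hd Is) (last Is)"
  shows "(\<exists>ps. subordinate_path W Is ps \<and> p = last ps) \<longleftrightarrow> p \<subseteq> gen_prod Is"
  using assms
proof (induction Is arbitrary: p rule: rev_induct)
  case Nil
  then show ?case by (simp add: is_expression_def)
next
  case (snoc K Is)
  have sub: "\<forall>K\<in>set (Is @ [K]). K \<subseteq> S" using snoc.prems(1) is_expression_subset by blast
  then have K: "K \<subseteq> S" by simp
  show ?case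
  proof (cases "Is = []")
    case True
    have p: "p \<in> double_cosets W K K" using snoc True by simp
    have g: "gen_prod (Is @ [K]) = par K" using True par_closed[OF K] by simp
    have "\<one> \<in> p \<longleftrightarrow> p \<subseteq> par K"
    proof
      assume "\<one> \<in> p"
      then show "p \<subseteq> par K"
        using double_coset_subset[OF K K p, of \<one> "par K"] par_absorb[of K K] K generate.one by blast
    next
      assume "p \<subseteq> par K"
      moreover obtain x where "x \<in> p" using double_coset_nonempty[OF p] by blast
      ultimately have x: "x \<in> p" "x \<in> par K" "x \<in> carrier W" using par_closed[OF K] by auto
      then have "inv x \<in> par K" using subgroup.m_inv_closed[OF par_subgroup[OF K]] by simp
      from double_coset_mult[OF K K p x(1) this generate.one] show "\<one> \<in> p" using x by simp
    qed
    moreover have "(\<exists>ps. subordinate_path W [K] ps \<and> p = last ps) \<longleftrightarrow> \<one> \<in> p"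
    proof
      assume "\<exists>ps. subordinate_path W [K] ps \<and> p = last ps"
      then obtain ps where "subordinate_path W [K] ps" "p = last ps" by blast
      moreover from this(1) obtain r where "ps = [r]"
        by (auto simp: subordinate_path_def length_Suc_conv)
      ultimately show "\<one> \<in> p" by (simp add: subordinate_path_def)
    next
      assume "\<one> \<in> p"
      then have "subordinate_path W [K] [p]" using p by (simp add: subordinate_path_def)
      then show "\<exists>ps. subordinate_path W [K] ps \<and> p = last ps" by (metis last.simps)
    qed
    ultimately show ?thesis using True g by simp
  next
    case False
    let ?I = "hd Is" and ?L = "last Is"
    have e: "is_expression W S Is" using snoc.prems(1) is_expression_snoc False by blast
    have I: "?I \<subseteq> S" and L: "?L \<subseteq> S" using sub False by auto
    have p: "p \<in> double_cosets W ?I K" using snoc.prems(2) False by simp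
    have gp: "gen_prod (Is @ [K]) = gen_prod Is <#> par K" using gen_prod_snoc sub by simp
    have hdg: "par ?I <#> gen_prod (Is @ [K]) = gen_prod (Is @ [K])"
      using gen_prod_hd[of "Is @ [K]"] sub False by simp
    have lastg: "gen_prod (Is @ [K]) <#> par K = gen_prod (Is @ [K])"
      using gen_prod_last[of "Is @ [K]" K] sub by simp
    have subg: "gen_prod Is \<subseteq> gen_prod (Is @ [K])"
    proof
      fix x assume x: "x \<in> gen_prod Is"
      then have "x = x \<otimes> \<one>" using gen_prod_carrier[of Is] sub by auto
      then show "x \<in> gen_prod (Is @ [K])"
        unfolding gp set_mult_iff using x generate.one[of W K] by blast
    qed
    have stab: "par ?I <#> gen_prod Is = gen_prod Is" "gen_prod Is <#> par ?L = gen_prod Is"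
      using gen_prod_hd gen_prod_last sub False by auto
    note steps = is_expression_snoc_cases[OF False snoc.prems(1)]
    have IH: "(\<exists>ps. subordinate_path W Is ps \<and> r = last ps) \<longleftrightarrow> r \<subseteq> gen_prod Is"
      if "r \<in> double_cosets W ?I ?L" for r using snoc.IH e that by blast
    have path_len: "length ps = length Is" if "subordinate_path W Is ps" for ps
      using that by (simp add: subordinate_path_def)
    have last_path: "last ps \<in> double_cosets W ?I ?L" if "subordinate_path W Is ps" for ps
    proof -
      have "ps \<noteq> []" using path_len[OF that] False by auto
      moreover have "ps ! (length Is - 1) \<in> double_cosets W (Is ! 0) (Is ! (length Is - 1))"
        using that False by (simp add: subordinate_path_def)
      ultimately show ?thesis
        using path_len[OF that] False by (simp add: last_conv_nth hd_conv_nth)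
    qed
    show ?thesis
    proof
      assume "\<exists>ps. subordinate_path W (Is @ [K]) ps \<and> p = last ps"
      then obtain qs where qs: "subordinate_path W (Is @ [K]) qs" "p = last qs" by blast
      then have "length qs = Suc (length Is)" by (simp add: subordinate_path_def)
      then obtain ps where ps: "qs = ps @ [p]" "length ps = length Is"
        using qs(2) by (metis append_butlast_last_id diff_Suc_1 length_butlast length_0_conv nat.distinct(1))
      then have path: "subordinate_path W Is ps" and
        up: "?L \<subset> K \<longrightarrow> last ps \<subseteq> p" and down: "K \<subset> ?L \<longrightarrow> p \<subseteq> last ps"
        using qs(1) subordinate_path_snoc[OF False ps(2)] by auto
      then have "last ps \<subseteq> gen_prod Is" using IH last_path by blast
      moreover obtain x where "x \<in> last ps" using double_coset_nonempty last_path[OF path] by blast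
      moreover obtain z where "z \<in> p" using double_coset_nonempty p by blast
      \<comment> \<open>For an ascending last step the point of \<open>last ps\<close> lies in
        \<open>p\<close>; for a descending one any point of \<open>p\<close> lies in
        \<open>last ps\<close>. One point suffices because the product is a union of cosets.\<close>
      ultimately obtain x where "x \<in> p" "x \<in> gen_prod (Is @ [K])"
        using up down steps subg by blast
      then show "p \<subseteq> gen_prod (Is @ [K])"
        using double_coset_subset[OF I K p] hdg lastg by blast
    next
      assume pg: "p \<subseteq> gen_prod (Is @ [K])"
      obtain x where x: "x \<in> p" using double_coset_nonempty p by blast
      have "\<exists>r\<in>double_cosets W ?I ?L. r \<subseteq> gen_prod Is \<and> (?L \<subset> K \<longrightarrow> r \<subseteq> p) \<and> (K \<subset> ?L \<longrightarrow> p \<subseteq> r)"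
      proof (cases "?L \<subset> K")
        case True
        \<comment> \<open>Ascending: stripping the \<open>W_K\<close> factor from a point of
          \<open>p\<close> yields a point of \<open>p\<close> in the shorter product, and its coset
          is the predecessor.\<close>
        have "x \<in> gen_prod Is <#> par K" using x pg gp by blast
        then obtain a b where a: "a \<in> gen_prod Is" "b \<in> par K" "x = a \<otimes> b"
          unfolding set_mult_iff by blast
        have c: "a \<in> carrier W" "b \<in> carrier W" using a gen_prod_carrier sub par_closed[OF K] by auto
        have "inv b \<in> par K" using subgroup.m_inv_closed[OF par_subgroup[OF K]] a by simp
        from double_coset_mult[OF I K p x generate.one this] have ap: "a \<in> p"
          using a c by (simp add: m_assoc)
        obtain r where r: "r \<in> double_cosets W ?I ?L" "a \<in> r" using double_coset_self c by blast
        have "r \<subseteq> gen_prod Is" using double_coset_subset[OF I L r a(1)] stab by blast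
        moreover have "r \<subseteq> p" using double_coset_order_mono[OF I K _ r(1) p r(2) ap] True by blast
        ultimately show ?thesis using r True by blast
      next
        case False
        then have KL: "K \<subset> ?L" using steps by blast
        \<comment> \<open>Descending: the product does not change, so the larger coset around a
          point of \<open>p\<close> can serve as predecessor.\<close>
        have "gen_prod (Is @ [K]) = gen_prod Is"
          unfolding gp using gen_prod_last[of Is K] \<open>Is \<noteq> []\<close> sub KL by auto
        then have xg: "x \<in> gen_prod Is" using x pg by blast
        then have "x \<in> carrier W" using gen_prod_carrier sub by auto
        then obtain r where r: "r \<in> double_cosets W ?I ?L" "x \<in> r" using double_coset_self by blast
        have "r \<subseteq> gen_prod Is" using double_coset_subset[OF I L r xg] stab by blast
        moreover have "p \<subseteq> r" using double_coset_order_mono[OF I L _ p r(1) x r(2)] KL by blast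
        ultimately show ?thesis using r False by blast
      qed
      then obtain r where r: "r \<in> double_cosets W ?I ?L" "r \<subseteq> gen_prod Is"
        "?L \<subset> K \<longrightarrow> r \<subseteq> p" "K \<subset> ?L \<longrightarrow> p \<subseteq> r" by blast
      then obtain ps where ps: "subordinate_path W Is ps" "r = last ps" using IH by blast
      then have "subordinate_path W (Is @ [K]) (ps @ [p])"
        using subordinate_path_snoc[OF False path_len[OF ps(1)]] r p by blast
      then show "\<exists>ps. subordinate_path W (Is @ [K]) ps \<and> p = last ps"
        by (intro exI[of _ "ps @ [p]"]) simp
    qed
  qed
qed

lemma path_to_iff_le:
  assumes "expresses W S I J Is q" "p \<in> double_cosets W I J"
  shows "(\<exists>ps. subordinate_path W Is ps \<and> p = last ps) \<longleftrightarrow>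
    le (coset_max W S p) (coset_max W S q)"
proof -
  have e: "is_expression W S Is" "hd Is = I" "last Is = J" "q \<in> double_cosets W I J"
    "coset_max W S q = star_prod W S (map (longest W S) Is)"
    using assms(1) by (auto simp: expresses_def)
  have I: "finitary W S I" and J: "finitary W S J" using is_expression_hd_last[OF e(1)] e by auto
  note maxp = coset_max_props[OF I J assms(2)]
  have "below (coset_max W S q) = gen_prod Is"
    using below_star_prod[OF is_expression_finitary[OF e(1)]] e by simp
  \<comment> \<open>A lower set contains \<open>p\<close> exactly when it contains the greatest
    element of \<open>p\<close>.\<close>
  moreover have "p \<subseteq> below (coset_max W S q) \<longleftrightarrow> le (coset_max W S p) (coset_max W S q)"
    using maxp(1,2) le_trans by (auto simp: subset_iff)
  ultimately show ?thesis using path_terminus_iff[OF e(1)] e assms(2) by auto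
qed

section \<open>Minimal coset representatives\<close>

lemma finitary_subset: "finitary W S K \<Longrightarrow> L \<subseteq> K \<Longrightarrow> finitary W S L"
  unfolding finitary_def using mono_generate[of L K] finite_subset by blast

lemma finitary_finite: "finitary W S K \<Longrightarrow> finite K"
  unfolding finitary_def using par_gen by (meson finite_subset subsetI)

lemma le_par_mult:
  assumes "I \<subseteq> S" "a \<in> par I" "y \<in> carrier W" "\<And>s. s \<in> I \<Longrightarrow> le y (s \<otimes> y)"
  shows "le y (a \<otimes> y)"
proof -
  have a: "a \<in> carrier W" "inv a \<in> par I"
    using assms par_closed subgroup.m_inv_closed[OF par_subgroup[OF assms(1)]] by auto
  have "le y (inv a \<otimes> (a \<otimes> y))" using a assms by simp
  then show ?thesis using le_par_cancel[OF assms(1) a(2), of "a \<otimes> y" y] a assms by simp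
qed

text \<open>Without a left descent in \<open>I\<close>, the factor \<open>a\<close> could be
  cancelled from \<open>a\<close> below \<open>a 1\<close>, leaving \<open>a\<close> below the
  identity.\<close>

lemma par_descent:
  assumes "I \<subseteq> S" "a \<in> par I" "a \<noteq> \<one>"
  shows "\<exists>s\<in>I. len (s \<otimes> a) < len a"
proof (rule ccontr)
  have a: "a \<in> carrier W" using assms par_closed by blast
  assume "\<not> (\<exists>s\<in>I. len (s \<otimes> a) < len a)"
  then have "le a (s \<otimes> a)" if "s \<in> I" for s
    using that assms(1) a len_gen_neq[of s a] by (intro le_gen_mult) (auto simp: nat_neq_iff)
  then have "le a \<one>" using le_par_cancel[OF assms(1,2), of \<one> a] a by simp
  then have "a \<in> below \<one>" by (simp del: below_one)
  then show False using assms by simp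
qed

text \<open>The standard length formula for a minimal representative \<open>y\<close> of
  \<open>W_I y\<close>.\<close>

lemma len_par_mult:
  assumes "I \<subseteq> S" "a \<in> par I" "y \<in> carrier W" "\<And>s. s \<in> I \<Longrightarrow> le y (s \<otimes> y)"
  shows "len (a \<otimes> y) = len a + len y"
  using assms(2)
proof (induction "len a" arbitrary: a rule: less_induct)
  case less
  show ?case
  proof (cases "a = \<one>")
    case False
    then obtain s where s: "s \<in> I" "len (s \<otimes> a) < len a"
      using par_descent assms(1) less.prems by blast
    have sS: "s \<in> S" using s assms by blast
    have a: "a \<in> carrier W" using less.prems par_closed assms(1) by blast
    define b where "b = s \<otimes> a"
    have b: "b \<in> par I" "b \<in> carrier W" "a = s \<otimes> b" "len b < len a"
      using s sS a less.prems by (auto simp: b_def intro: generate.eng par_gen)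
    have IH: "len (b \<otimes> y) = len b + len y" using less.hyps b by blast
    have "inv b \<in> par I" by (rule subgroup.m_inv_closed[OF par_subgroup[OF assms(1)] b(1)])
    then have r: "inv b \<otimes> s \<otimes> b \<in> par I" by (intro generate.eng b(1) par_gen[OF s(1)])
    \<comment> \<open>Cocycle rule for \<open>b\<close> and \<open>y\<close>: \<open>s\<close>
      lengthens \<open>b\<close>, and the conjugate \<open>b^-1 s b\<close> lies in
      \<open>W_I\<close>, so it cannot shorten the minimal \<open>y\<close>. Hence \<open>s\<close>
      lengthens \<open>b y\<close>.\<close>
    have "\<not> len (inv b \<otimes> s \<otimes> b \<otimes> y) < len y"
      using le_len[OF le_par_mult[OF assms(1) r assms(3,4)]] by simp
    then have "\<not> len (s \<otimes> (b \<otimes> y)) < len (b \<otimes> y)"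
      using len_cocycle[of s b y] sS b assms(3) by simp
    then have "len (b \<otimes> y) < len (s \<otimes> (b \<otimes> y))"
      using len_gen_neq[of s "b \<otimes> y"] sS b assms(3) by simp
    moreover have "len a \<le> Suc (len b)" "len (a \<otimes> y) \<le> len a + len y"
      using len_mult_le[of s b] len_mult_le[of a y] sS a b assms(3) by simp_all
    ultimately show ?thesis using IH b sS assms(3) by (simp add: m_assoc)
  qed (simp add: assms)
qed

lemma len_par_right_mult:
  assumes "J \<subseteq> S" "c \<in> par J" "y \<in> carrier W" "\<And>s. s \<in> J \<Longrightarrow> le y (y \<otimes> s)"
  shows "len (y \<otimes> c) = len y + len c"
proof -
  have c: "c \<in> carrier W" "inv c \<in> par J"
    using assms par_closed subgroup.m_inv_closed[OF par_subgroup[OF assms(1)]] by auto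
  have "le (inv y) (s \<otimes> inv y)" if "s \<in> J" for s
    using le_inv[OF assms(4)[OF that]] that assms by (auto simp: inv_mult_group)
  then have "len (inv c \<otimes> inv y) = len c + len y"
    using len_par_mult[OF assms(1) c(2), of "inv y"] c assms(3) by simp
  then show ?thesis using len_inv[of "y \<otimes> c"] c assms(3)
    by (simp add: inv_mult_group del: len_inv)
qed

text \<open>The element \<open>v\<close> is the minimal representative of the coset
  \<open>W_L w_J\<close>; the last claim expresses this.\<close>

lemma longest_factor:
  assumes J: "finitary W S J" and "L \<subseteq> J"
  defines "v \<equiv> inv (longest W S L) \<otimes> longest W S J"
  shows "v \<in> par J" and "longest W S J = longest W S L \<otimes> v"
    and "len (longest W S J) = len (longest W S L) + len v"
    and "\<And>a. a \<in> par L \<Longrightarrow> len (a \<otimes> v) = len a + len v"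
proof -
  have L: "finitary W S L" using finitary_subset assms by blast
  note LS = finitary_par(1)[OF L] and JS = finitary_par(1)[OF J]
  note wL = longest_props[OF L] and wJ = longest_props[OF J]
  note c = longest_carrier[OF L] longest_carrier[OF J]
  have LJ: "par L \<subseteq> par J" using mono_generate assms(2) by blast
  show "v \<in> par J" unfolding v_def
    using wL wJ LJ by (intro generate.eng subgroup.m_inv_closed[OF par_subgroup[OF JS]]) auto
  show 1: "longest W S J = longest W S L \<otimes> v" unfolding v_def using c by simp
  \<comment> \<open>An \<open>(L, {})\<close>-coset is a one-sided coset of \<open>W_L\<close>, so
    minima of double cosets cover this case.\<close>
  obtain p where p: "p \<in> double_cosets W L {}" "longest W S J \<in> p"
    using double_coset_self c by blast
  define u where "u = coset_min W S p"
  note min = coset_min_props[OF LS empty_subsetI p(1)]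
  obtain a d where a: "a \<in> par L" "d \<in> par {}" "longest W S J = a \<otimes> u \<otimes> d"
    using double_coset_connected[OF LS empty_subsetI p(1) min(1) p(2)] unfolding u_def by blast
  have u: "u \<in> carrier W"
    using min(1) double_coset_carrier[OF LS empty_subsetI p(1)] unfolding u_def by blast
  have ac: "a \<in> carrier W" using a par_closed LS by blast
  have "d = \<one>" using a(2) by (simp add: generate_empty)
  then have au: "longest W S J = a \<otimes> u" using a ac u by simp
  have add: "len (b \<otimes> u) = len b + len u" if "b \<in> par L" for b
    using len_par_mult[OF LS that u] min(3) unfolding u_def by blast
  have "u = inv a \<otimes> longest W S J" using au ac u by simp
  then have "u \<in> par J"
    using wJ(1) a(1) LJ by (auto intro: generate.eng subgroup.m_inv_closed[OF par_subgroup[OF JS]])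
  then have "longest W S L \<otimes> u \<in> par J" using wL(1) LJ by (auto intro: generate.eng)
  \<comment> \<open>Replacing \<open>a\<close> by \<open>w_L\<close> in \<open>w_J = a u\<close>
    stays in \<open>W_J\<close>, so maximality of \<open>w_J\<close> leaves no room for a shorter
    \<open>a\<close>.\<close>
  then have "len (longest W S L) \<le> len a"
    using wJ(3)[of "longest W S L \<otimes> u"] add[OF wL(1)] add[OF a(1)] au by simp
  then have "a = longest W S L" using longest_eqI[OF L a(1)] by blast
  then have uv: "u = v" unfolding v_def using au u c by simp
  show "len (longest W S J) = len (longest W S L) + len v" using 1 add[OF wL(1)] uv by simp
  show "\<And>a. a \<in> par L \<Longrightarrow> len (a \<otimes> v) = len a + len v" using add uv by simp
qed

lemma longest_inv:
  assumes "finitary W S J"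
  shows "inv (longest W S J) = longest W S J"
  using longest_eqI[OF assms, of "inv (longest W S J)"] longest_props[OF assms]
    subgroup.m_inv_closed[OF par_subgroup[OF finitary_par(1)[OF assms]]] longest_carrier[OF assms]
  by simp

text \<open>Reducedness uses \<open>w_J w_L^-1\<close>, the inverse of the \<open>v\<close> of
  \<open>longest_factor\<close>, as longest elements are involutions.\<close>

lemma len_longest_quotient:
  assumes J: "finitary W S J" and "L \<subseteq> J"
  shows "len (longest W S J \<otimes> inv (longest W S L)) + len (longest W S L) = len (longest W S J)"
proof -
  have L: "finitary W S L" using finitary_subset assms by blast
  note c = longest_carrier[OF L] longest_carrier[OF J]
  have "inv (longest W S J \<otimes> inv (longest W S L)) = inv (longest W S L) \<otimes> longest W S J"
    using c longest_inv[OF L] longest_inv[OF J] by (simp add: inv_mult_group)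
  then have "len (longest W S J \<otimes> inv (longest W S L)) = len (inv (longest W S L) \<otimes> longest W S J)"
    using len_inv[of "longest W S J \<otimes> inv (longest W S L)"] c by (simp del: len_inv)
  then show ?thesis using longest_factor(3)[OF assms] by simp
qed

section \<open>Reduced expressions\<close>

text \<open>Appending \<open>K\<close> can affect only the status of the previous last entry
  \<open>L\<close>. \<open>M\<close> collects the maxima strictly before \<open>L\<close>, which are
  the same for every \<open>K\<close>.\<close>

lemma local_maxima_snoc:
  fixes xs :: "'a set list" and L :: "'a set"
  obtains M where
    "local_maxima (xs @ [L]) = M @ (if xs = [] \<or> last xs \<subset> L then [L] else [])"
    "\<And>K. local_maxima (xs @ [L, K]) =
      M @ (if (xs = [] \<or> last xs \<subset> L) \<and> K \<subset> L then [L] else []) @ (if L \<subset> K then [K] else [])"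
proof -
  define g where "g zs k = (if (k = 0 \<or> zs ! (k - 1) \<subset> zs ! k) \<and>
    (Suc k = length zs \<or> zs ! Suc k \<subset> zs ! k) then [zs ! k] else [])" for zs :: "'a set list" and k
  define M where "M = concat (map (g (xs @ [L])) [0..<length xs])"
  have max: "local_maxima zs = concat (map (g zs) [0..<length zs])" for zs
    unfolding local_maxima_def g_def ..
  have "map (g (xs @ [L, K])) [0..<length xs] = map (g (xs @ [L])) [0..<length xs]" for K
    by (rule map_cong) (auto simp: nth_append nth_Cons' g_def)
  then have *: "concat (map (g (xs @ [L, K])) [0..<length xs]) = M" for K
    unfolding M_def by (simp only:)
  have "g (xs @ [L]) (length xs) = (if xs = [] \<or> last xs \<subset> L then [L] else [])"
    by (cases xs rule: rev_cases) (simp_all add: g_def nth_append)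
  then have 1: "local_maxima (xs @ [L]) = M @ (if xs = [] \<or> last xs \<subset> L then [L] else [])"
    by (simp add: max M_def)
  have "g (xs @ [L, K]) (length xs) = (if (xs = [] \<or> last xs \<subset> L) \<and> K \<subset> L then [L] else [])" for K
    by (cases xs rule: rev_cases) (simp_all add: g_def nth_append)
  moreover have "g (xs @ [L, K]) (Suc (length xs)) = (if L \<subset> K then [K] else [])" for K
    by (simp add: g_def nth_append)
  ultimately have 2: "local_maxima (xs @ [L, K]) =
      M @ (if (xs = [] \<or> last xs \<subset> L) \<and> K \<subset> L then [L] else []) @ (if L \<subset> K then [K] else [])" for K
    using * by (simp add: max)
  show thesis using that 1 2 by blast
qed

lemma inner_minima_snoc:
  fixes xs :: "'a set list" and L K :: "'a set"
  shows
  "inner_minima (xs @ [L, K]) = inner_minima (xs @ [L]) @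
    (if xs \<noteq> [] \<and> L \<subset> last xs \<and> L \<subset> K then [L] else [])"
proof -
  define g where "g zs k = (if 0 < k \<and> Suc k < length zs \<and> zs ! k \<subset> zs ! (k - 1) \<and> zs ! k \<subset> zs ! Suc k
    then [zs ! k] else [])" for zs :: "'a set list" and k
  have min: "inner_minima zs = concat (map (g zs) [0..<length zs])" for zs
    unfolding inner_minima_def g_def ..
  have "map (g (xs @ [L, K])) [0..<length xs] = map (g (xs @ [L])) [0..<length xs]"
    by (rule map_cong) (auto simp: nth_append nth_Cons' g_def)
  then have *: "concat (map (g (xs @ [L, K])) [0..<length xs]) =
      concat (map (g (xs @ [L])) [0..<length xs])"
    by (simp only:)
  have "g (xs @ [L, K]) (length xs) = (if xs \<noteq> [] \<and> L \<subset> last xs \<and> L \<subset> K then [L] else [])"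
    by (cases xs rule: rev_cases) (simp_all add: g_def nth_append)
  moreover have "g (xs @ [L, K]) (Suc (length xs)) = []" "g (xs @ [L]) (length xs) = []"
    by (simp_all add: g_def)
  ultimately show ?thesis using * by (simp add: min)
qed

lemma local_maxima_singleton: "local_maxima [I] = [I]" "inner_minima [I] = []"
  by (simp_all add: local_maxima_def inner_minima_def)

lemma set_local_maxima: "set (local_maxima Is) \<subseteq> set Is" "set (inner_minima Is) \<subseteq> set Is"
  by (auto simp: local_maxima_def inner_minima_def split: if_splits)

text \<open>The count ensures that \<open>map2\<close> in \<open>expression_factors\<close>
  truncates nothing; the inclusion makes the quotient of the last maximum by a new minimum
  length-additive.\<close>

lemma expression_shape:
  assumes "is_expression W S Is"
  shows "local_maxima Is \<noteq> [] \<and> length (local_maxima Is) = Suc (length (inner_minima Is)) \<and>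
    last Is \<subseteq> last (local_maxima Is)"
  using assms
proof (induction Is rule: rev_induct)
  case (snoc K Is)
  show ?case
  proof (cases "Is = []")
    case False
    then have e: "is_expression W S Is" using snoc.prems is_expression_snoc by blast
    have st: "last Is \<subset> K \<or> K \<subset> last Is" using is_expression_snoc_cases False snoc.prems by blast
    obtain xs L where Is: "Is = xs @ [L]" using False by (metis append_butlast_last_id)
    have st': "xs = [] \<or> last xs \<subset> L \<or> L \<subset> last xs"
      using is_expression_snoc_cases[of xs L] e Is by auto
    obtain M where M: "local_maxima (xs @ [L]) = M @ (if xs = [] \<or> last xs \<subset> L then [L] else [])"
      "\<And>K. local_maxima (xs @ [L, K]) =
        M @ (if (xs = [] \<or> last xs \<subset> L) \<and> K \<subset> L then [L] else []) @ (if L \<subset> K then [K] else [])"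
      using local_maxima_snoc[of xs L] by blast
    have IH: "local_maxima (xs @ [L]) \<noteq> []"
      "length (local_maxima (xs @ [L])) = Suc (length (inner_minima (xs @ [L])))"
      "L \<subseteq> last (local_maxima (xs @ [L]))"
      using snoc.IH[OF e] Is by auto
    show ?thesis using IH st st' M(1) M(2)[of K] inner_minima_snoc[of xs L K] unfolding Is
      by (auto split: if_splits)
  qed (simp add: local_maxima_singleton)
qed (simp add: is_expression_def)

lemma expression_factors_carrier:
  assumes "is_expression W S Is"
  shows "set (expression_factors W S Is) \<subseteq> carrier W"
proof -
  have "longest W S K \<in> carrier W" if "K \<in> set (local_maxima Is) \<union> set (inner_minima Is)" for K
    using that set_local_maxima[of Is] is_expression_finitary[OF assms] longest_carrier by blast
  then show ?thesis using expression_shape[OF assms] unfolding expression_factors_def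
    by (auto dest: set_zip_leftD set_zip_rightD in_set_butlastD)
qed

text \<open>If the last entry was a maximum as an end point, it remains one as a peak, and an inner
  minimum appears only at the next ascent.\<close>

lemma expression_factors_down:
  assumes "is_expression W S (Is @ [K])" "Is \<noteq> []" "K \<subset> last Is"
  shows "expression_factors W S (Is @ [K]) = expression_factors W S Is"
proof -
  obtain xs L where Is: "Is = xs @ [L]" using assms(2) by (metis append_butlast_last_id)
  obtain M where M: "local_maxima (xs @ [L]) = M @ (if xs = [] \<or> last xs \<subset> L then [L] else [])"
    "\<And>K. local_maxima (xs @ [L, K]) =
      M @ (if (xs = [] \<or> last xs \<subset> L) \<and> K \<subset> L then [L] else []) @ (if L \<subset> K then [K] else [])"
    using local_maxima_snoc[of xs L] by blast
  have "local_maxima (Is @ [K]) = local_maxima Is" "inner_minima (Is @ [K]) = inner_minima Is"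
    using assms(3) M(1) M(2)[of K] inner_minima_snoc[of xs L K] unfolding Is by auto
  then show ?thesis by (simp add: expression_factors_def)
qed

text \<open>Whether the ascent continues a rise or starts a new one, the net effect is the factor
  \<open>w_L^-1 w_K\<close>. The length identity is written additively to avoid truncated
  subtraction.\<close>

lemma expression_factors_up:
  assumes e: "is_expression W S (Is @ [K])" and ne: "Is \<noteq> []" and up: "last Is \<subset> K"
  shows "wprod (expression_factors W S (Is @ [K])) =
      wprod (expression_factors W S Is) \<otimes> inv (longest W S (last Is)) \<otimes> longest W S K"
    and "sum_list (map len (expression_factors W S (Is @ [K]))) + len (longest W S (last Is)) =
      sum_list (map len (expression_factors W S Is)) + len (longest W S K)"
proof -
  obtain xs L where Is: "Is = xs @ [L]" using ne by (metis append_butlast_last_id)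
  obtain M where M: "local_maxima (xs @ [L]) = M @ (if xs = [] \<or> last xs \<subset> L then [L] else [])"
    "\<And>K. local_maxima (xs @ [L, K]) =
      M @ (if (xs = [] \<or> last xs \<subset> L) \<and> K \<subset> L then [L] else []) @ (if L \<subset> K then [K] else [])"
    using local_maxima_snoc[of xs L] by blast
  have e': "is_expression W S Is" using e is_expression_snoc ne by blast
  note shape = expression_shape[OF e'] and fc = expression_factors_carrier[OF e']
  have LK: "L \<subset> K" using up Is by simp
  have st: "xs = [] \<or> last xs \<subset> L \<or> L \<subset> last xs"
    using is_expression_snoc_cases[of xs L] e' Is by auto
  let ?w = "longest W S" and ?f = "\<lambda>K L. longest W S K \<otimes> inv (longest W S L)"
  have cL: "?w L \<in> carrier W" and cK: "?w K \<in> carrier W"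
    using is_expression_finitary[OF e] Is longest_carrier by auto
  have maxK: "local_maxima (Is @ [K]) = M @ [K]" using M(2)[of K] LK Is by auto
  have "wprod (expression_factors W S (Is @ [K])) =
      wprod (expression_factors W S Is) \<otimes> inv (?w L) \<otimes> ?w K \<and>
    sum_list (map len (expression_factors W S (Is @ [K]))) + len (?w L) =
      sum_list (map len (expression_factors W S Is)) + len (?w K)"
  proof (cases "xs = [] \<or> last xs \<subset> L")
    case True
    have "inner_minima (Is @ [K]) = inner_minima Is" using True inner_minima_snoc[of xs L K] Is by auto
    moreover have "local_maxima Is = M @ [L]" using True M Is by simp
    ultimately obtain F where F: "expression_factors W S Is = F @ [?w L]"
      "expression_factors W S (Is @ [K]) = F @ [?w K]"
      using maxK by (simp add: expression_factors_def)
    have "wprod F \<in> carrier W"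
      using fc F(1) by (simp add: group_prod_closed)
    then show ?thesis using F fc cL cK by (simp add: group_prod_append m_assoc)
  next
    \<comment> \<open>\<open>L\<close> becomes an inner minimum: the final factor \<open>w_A\<close>
      turns into \<open>w_A w_L^-1\<close>, and \<open>w_K\<close> is added.\<close>
    case False
    have mK: "inner_minima (Is @ [K]) = inner_minima Is @ [L]"
      using False st LK inner_minima_snoc[of xs L K] Is by auto
    have M': "local_maxima Is = M" using False M Is by simp
    then obtain B A where B: "M = B @ [A]" using shape by (metis append_butlast_last_id)
    have A: "finitary W S A" "L \<subseteq> A"
      using B M' shape set_local_maxima(1)[of Is] is_expression_finitary[OF e'] Is by auto
    have lB: "length B = length (inner_minima Is)" using shape M' B by simp
    obtain F where F: "expression_factors W S Is = F @ [?w A]"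
      "expression_factors W S (Is @ [K]) = F @ [?f A L, ?w K]"
      using maxK mK M' B lB by (simp add: expression_factors_def butlast_append)
    have cX: "?w A \<in> carrier W" using longest_carrier A by blast
    have "wprod F \<in> carrier W"
      using fc F(1) by (simp add: group_prod_closed)
    moreover have "len (?f A L) + len (?w L) = len (?w A)" using len_longest_quotient A by blast
    ultimately show ?thesis using F fc cL cK cX by (simp add: group_prod_append m_assoc)
  qed
  then show "wprod (expression_factors W S (Is @ [K])) =
      wprod (expression_factors W S Is) \<otimes> inv (longest W S (last Is)) \<otimes> longest W S K"
    and "sum_list (map len (expression_factors W S (Is @ [K]))) + len (longest W S (last Is)) =
      sum_list (map len (expression_factors W S Is)) + len (longest W S K)"
    using Is by auto
qed

text \<open>
  The length \<open>n\<close> is an integer, since \<open>\<ell>(w\<^sub>L)\<close> is subtracted when an expression ascends from \<open>L\<close>.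
\<close>

definition expression_with :: "'a set \<Rightarrow> 'a set \<Rightarrow> 'a set \<Rightarrow> 'a \<Rightarrow> int \<Rightarrow> bool" where
  "expression_with I K A g n \<longleftrightarrow> (\<exists>Is. is_expression W S Is \<and> hd Is = I \<and> last Is = K \<and>
     gen_prod Is = A \<and> wprod (expression_factors W S Is) = g \<and>
     int (sum_list (map len (expression_factors W S Is))) = n)"

section \<open>Building expressions entry by entry\<close>

lemma expression_with_singleton:
  assumes "finitary W S I"
  shows "expression_with I I (par I) (longest W S I) (len (longest W S I))"
  unfolding expression_with_def
  using assms par_closed[of I] longest_carrier[OF assms]
  by (intro exI[of _ "[I]"])
    (simp add: is_expression_def expression_factors_def local_maxima_singleton finitary_par)

lemma expression_with_facts:
  assumes "expression_with I K A g n"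
  shows "finitary W S K \<and> g \<in> carrier W \<and> A \<subseteq> carrier W \<and> A <#> par K = A"
proof -
  obtain Is where Is: "is_expression W S Is" "last Is = K" "gen_prod Is = A"
    "wprod (expression_factors W S Is) = g"
    using assms unfolding expression_with_def by blast
  have ne: "Is \<noteq> []" using Is by (simp add: is_expression_def)
  have "g \<in> carrier W"
    using group_prod_closed[OF expression_factors_carrier[OF Is(1)]] Is(4) by blast
  then show ?thesis
    using Is gen_prod_carrier[of Is] gen_prod_last[OF ne, of K] is_expression_subset[OF Is(1)]
      is_expression_hd_last[OF Is(1)] by auto
qed

lemma expression_with_remove:
  assumes "expression_with I K A g n" "s \<in> K"
  shows "expression_with I (K - {s}) A g n"
proof -
  obtain Is where Is: "is_expression W S Is" "hd Is = I" "last Is = K" "gen_prod Is = A"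
    "wprod (expression_factors W S Is) = g" "int (sum_list (map len (expression_factors W S Is))) = n"
    using assms(1) unfolding expression_with_def by blast
  have ne: "Is \<noteq> []" using Is by (simp add: is_expression_def)
  have K: "finitary W S K" using is_expression_hd_last Is by blast
  then have "finitary W S (K - {s})" "s \<in> S" using finitary_subset finitary_par assms(2) by blast+
  then have e: "is_expression W S (Is @ [K - {s}])"
    using is_expression_snoc[OF ne] Is assms(2) by blast
  have "gen_prod (Is @ [K - {s}]) = A"
    using gen_prod_snoc[of Is "K - {s}"] gen_prod_last[OF ne, of "K - {s}"]
      is_expression_subset[OF e] Is by auto
  moreover have "expression_factors W S (Is @ [K - {s}]) = expression_factors W S Is"
    using expression_factors_down[OF e ne] Is assms(2) by blast
  ultimately show ?thesis unfolding expression_with_def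
    using e Is ne by (intro exI[of _ "Is @ [K - {s}]"]) simp
qed

lemma expression_with_insert:
  assumes "expression_with I L A g n" "s \<notin> L" "finitary W S (insert s L)"
  shows "expression_with I (insert s L) (A <#> par (insert s L))
    (g \<otimes> inv (longest W S L) \<otimes> longest W S (insert s L))
    (n - len (longest W S L) + len (longest W S (insert s L)))"
proof -
  obtain Is where Is: "is_expression W S Is" "hd Is = I" "last Is = L" "gen_prod Is = A"
    "wprod (expression_factors W S Is) = g" "int (sum_list (map len (expression_factors W S Is))) = n"
    using assms(1) unfolding expression_with_def by blast
  have ne: "Is \<noteq> []" using Is by (simp add: is_expression_def)
  have "s \<in> S" using finitary_par assms(3) by blast
  then have e: "is_expression W S (Is @ [insert s L])"
    using is_expression_snoc[OF ne] Is assms(2,3) by blast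
  have "gen_prod (Is @ [insert s L]) = A <#> par (insert s L)"
    using gen_prod_snoc[of Is "insert s L"] is_expression_subset[OF e] Is by auto
  moreover have "last Is \<subset> insert s L" using Is assms(2) by blast
  note expression_factors_up[OF e ne this]
  ultimately show ?thesis unfolding expression_with_def
    using e Is ne by (intro exI[of _ "Is @ [insert s L]"]) simp
qed

lemma expression_with_shrink:
  assumes "finite D" "expression_with I K A g n" "D \<subseteq> K"
  shows "expression_with I (K - D) A g n"
  using assms
proof (induction D)
  case (insert s D)
  then have "expression_with I (K - D - {s}) A g n" by (intro expression_with_remove) auto
  then show ?case by (metis Diff_insert)
qed simp

text \<open>Inserting the elements of \<open>D\<close> singly telescopes: the intermediate longest
  elements cancel, and larger parabolics absorb the intermediate ones.\<close>

lemma expression_with_extend: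
  assumes "finite D" "expression_with I L A g n" "D \<inter> L = {}" "finitary W S (D \<union> L)"
  shows "expression_with I (D \<union> L) (A <#> par (D \<union> L))
    (g \<otimes> inv (longest W S L) \<otimes> longest W S (D \<union> L))
    (n - len (longest W S L) + len (longest W S (D \<union> L)))"
  using assms
proof (induction D)
  case empty
  then show ?case using expression_with_facts[OF empty(1)] longest_carrier[of L] by (simp add: m_assoc)
next
  case (insert s D)
  let ?K = "insert s (D \<union> L)"
  have K: "finitary W S ?K" using insert.prems by simp
  have DL: "finitary W S (D \<union> L)" by (rule finitary_subset[OF K]) blast
  have IH: "expression_with I (D \<union> L) (A <#> par (D \<union> L))
    (g \<otimes> inv (longest W S L) \<otimes> longest W S (D \<union> L))
    (n - len (longest W S L) + len (longest W S (D \<union> L)))"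
    using insert.IH insert.prems DL by blast
  note f = expression_with_facts[OF insert.prems(1)]
  have c: "longest W S L \<in> carrier W" "longest W S (D \<union> L) \<in> carrier W" "longest W S ?K \<in> carrier W"
    using f longest_carrier DL K by blast+
  have KS: "?K \<subseteq> S" using finitary_par K by blast
  have "A <#> par (D \<union> L) <#> par ?K = A <#> (par (D \<union> L) <#> par ?K)"
    using f KS by (intro set_mult_assoc) (simp_all add: par_closed)
  also have "par (D \<union> L) <#> par ?K = par ?K" using KS by (intro par_absorb) auto
  finally have "A <#> par (D \<union> L) <#> par ?K = A <#> par ?K" .
  moreover have "s \<notin> D \<union> L" using insert by blast
  note expression_with_insert[OF IH this K]
  ultimately show ?case using c f by (simp add: m_assoc)
qed

text \<open>
  Let \<open>x\<close> be minimal in \<open>p\<close> and \<open>J' = J \<inter> x\<inverse>Ix\<close>.  All of \<open>J'\<close>, and any right descent \<open>s\<close> of \<open>x\<close>, are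
  right descents of \<open>y = w\<^sub>Ix\<close>.  Hence \<open>J' \<union> {s}\<close> is finitary and \<open>y\<close> is the maximum of its coset,
  to which the induction hypothesis applies; then descend to \<open>J'\<close> and ascend to \<open>J\<close>.
\<close>

lemma reduced_expression_with:
  assumes I: "finitary W S I" and "finitary W S J" "p \<in> double_cosets W I J"
  shows "expression_with I J (below (coset_max W S p)) (coset_max W S p) (len (coset_max W S p))"
  using assms(2,3)
proof (induction "len (coset_min W S p)" arbitrary: J p rule: less_induct)
  case less
  note J = less.prems(1) and p = less.prems(2)
  note IS = finitary_par(1)[OF I] and JS = finitary_par(1)[OF J]
  note max = coset_max_props[OF I J p] and min = coset_min_props[OF IS JS p]
  define x where "x = coset_min W S p"
  define w where "w = longest W S I"
  define y where "y = w \<otimes> x"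
  define J' where "J' = {t\<in>J. x \<otimes> t \<otimes> inv x \<in> I}"
  define v where "v = inv (longest W S J') \<otimes> longest W S J"
  have x: "x \<in> carrier W" "x \<in> p" using min(1) double_coset_carrier[OF IS JS p] by (auto simp: x_def)
  have w: "w \<in> carrier W" "w \<in> par I" "below w = par I" "\<And>a. a \<in> par I \<Longrightarrow> len a \<le> len w"
    unfolding w_def using longest_carrier longest_props I by auto
  have y: "y \<in> carrier W" using x w y_def by simp
  have lx: "le x (s \<otimes> x)" if "s \<in> I" for s using min(3) that by (simp add: x_def)
  have rx: "le x (x \<otimes> s)" if "s \<in> J" for s using min(4) that by (simp add: x_def)
  have leny: "len y = len w + len x"
    unfolding y_def using len_par_mult[OF IS w(2) x(1) lx] by blast
  have belowy: "below y = par I <#> below x"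
    using below_mult[of w x] w x leny y_def by simp
  have J': "J' \<subseteq> J" "J' \<subseteq> S" "finitary W S J'"
    using finitary_subset[OF J, of J'] JS by (auto simp: J'_def)
  \<comment> \<open>Moving \<open>t\<close> across \<open>x\<close> turns it into an element of
    \<open>I\<close>, by which the longest element \<open>w\<close> cannot grow.\<close>
  have desc: "len (y \<otimes> t) < len y" if "t \<in> J'" for t
  proof -
    define s where "s = x \<otimes> t \<otimes> inv x"
    have s: "s \<in> I" and t: "t \<in> S" using that J' by (auto simp: s_def J'_def)
    have sc: "s \<in> carrier W" using s IS by auto
    have "y \<otimes> t = (w \<otimes> s) \<otimes> x" unfolding y_def s_def using x w t by (simp add: m_assoc)
    then have "len (y \<otimes> t) \<le> len (w \<otimes> s) + len x" using len_mult_le x w sc by simp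
    also have "\<dots> \<le> len y" using w(4)[of "w \<otimes> s"] w(2) s leny by (simp add: generate.eng par_gen)
    finally show ?thesis using len_right_gen_neq[OF t y] by simp
  qed
  have absorb: "below y <#> par J' = below y"
    using below_par_right_descents[OF J'(2) y desc] .
  have "\<exists>K. J' \<subseteq> K \<and> expression_with I K (below y) y (len y)"
  proof (cases "x = \<one>")
    case True
    then have "J' \<subseteq> I" "y = w" using J'(2) w by (auto simp: J'_def y_def)
    then show ?thesis using expression_with_singleton[OF I] w(3) unfolding w_def by auto
  next
    case False
    have "inv x \<in> par S" "inv x \<noteq> \<one>" using x False gens_generate by auto
    then obtain s where s: "s \<in> S" "len (s \<otimes> inv x) < len (inv x)" using par_descent by blast
    then have xs: "len (x \<otimes> s) < len x" using len_right_gen[of s x] x by simp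
    define K where "K = insert s J'"
    have KS: "K \<subseteq> S" using s J' by (simp add: K_def)
    have "len (y \<otimes> s) < len y"
      using len_mult_le[of w "x \<otimes> s"] xs w x s leny by (simp add: y_def m_assoc)
    then have absK: "below y <#> par K = below y"
      using desc by (intro below_par_right_descents[OF KS y]) (auto simp: K_def)
    \<comment> \<open>All of \<open>K\<close> are right descents of \<open>y\<close>, so
      \<open>W_K\<close> fits into a finite lower set; this makes \<open>K\<close> finitary.\<close>
    have "par K \<subseteq> below y"
    proof
      fix a assume a: "a \<in> par K"
      then have "a = \<one> \<otimes> a" using par_closed[OF KS] by auto
      moreover have "\<one> \<in> below y" using one_le y by simp
      ultimately have "a \<in> below y <#> par K" using a unfolding set_mult_iff by blast
      then show "a \<in> below y" using absK by simp
    qed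
    then have K: "finitary W S K"
      using finite_subset[OF _ finite_below[OF y]] KS by (simp add: finitary_def)
    obtain q where q: "q \<in> double_cosets W I K" "x \<in> q" using double_coset_self x by blast
    have "\<one> \<otimes> x \<otimes> s \<in> q"
      using double_coset_mult[OF IS KS q generate.one par_gen] by (simp add: K_def)
    \<comment> \<open>The coset of \<open>x\<close> for the labels \<open>I\<close> and
      \<open>K\<close> contains the shorter \<open>x s\<close>, so the induction measure
      drops.\<close>
    then have "le (coset_min W S q) (x \<otimes> s)" using coset_min_props(2)[OF IS KS q(1)] x by simp
    then have "len (coset_min W S q) < len x" using le_len xs by fastforce
    then have "expression_with I K (below (coset_max W S q)) (coset_max W S q) (len (coset_max W S q))"
      using less.hyps K q(1) unfolding x_def by blast
    moreover have "below (coset_max W S q) = below y"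
      using coset_max_props(3)[OF I K q] belowy absK by simp
    then have "coset_max W S q = y"
      using below_inject y coset_max_props(1)[OF I K q(1)] double_coset_carrier[OF IS KS q(1)] by blast
    ultimately show ?thesis unfolding K_def by auto
  qed
  then obtain K where K: "J' \<subseteq> K" "expression_with I K (below y) y (len y)" by blast
  have "finite (K - J')" "finite (J - J')"
    using expression_with_facts[OF K(2)] finitary_finite J by auto
  then have "expression_with I (K - (K - J')) (below y) y (len y)"
    using expression_with_shrink K by blast
  moreover have "K - (K - J') = J'" using K by blast
  ultimately have "expression_with I J' (below y) y (len y)" by simp
  from expression_with_extend[OF \<open>finite (J - J')\<close> this]
  have "expression_with I (J - J' \<union> J') (below y <#> par (J - J' \<union> J'))
    (y \<otimes> inv (longest W S J') \<otimes> longest W S (J - J' \<union> J'))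
    (int (len y) - len (longest W S J') + len (longest W S (J - J' \<union> J')))"
    using J J' by (simp add: Un_absorb2 Diff_Int_distrib2)
  moreover have "J - J' \<union> J' = J" using J'(1) by blast
  ultimately have E: "expression_with I J (below y <#> par J)
    (y \<otimes> inv (longest W S J') \<otimes> longest W S J) (int (len y) - len (longest W S J') + len (longest W S J))"
    by simp
  note vf = longest_factor[OF J J'(1), folded v_def]
  have v: "v \<in> carrier W" using vf(1) par_closed JS by blast
  have lenxv: "len (x \<otimes> c) = len x + len c" if "c \<in> par J" for c
    using len_par_right_mult[OF JS that x(1) rx] .
  \<comment> \<open>The crux: \<open>x v\<close> is minimal in \<open>W_I x v\<close>. Otherwise
    some \<open>s\<close> in \<open>I\<close> shortens \<open>x v\<close> but not \<open>x\<close>,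
    so \<open>r = x^-1 s x\<close> shortens \<open>v\<close>. Then \<open>r\<close> lies in
    \<open>W_J\<close>, and \<open>x r = s x\<close> forces it to have length one. So
    \<open>r\<close> is in \<open>J'\<close>, but no element of \<open>J'\<close> shortens
    \<open>v\<close>.\<close>
  have "le (x \<otimes> v) (s \<otimes> (x \<otimes> v))" if s: "s \<in> I" for s
  proof -
    have sS: "s \<in> S" using s IS by blast
    have "\<not> len (s \<otimes> (x \<otimes> v)) < len (x \<otimes> v)"
    proof
      assume "len (s \<otimes> (x \<otimes> v)) < len (x \<otimes> v)"
      moreover have "\<not> len (s \<otimes> x) < len x" using le_len[OF lx[OF s]] by simp
      ultimately have r: "len (inv x \<otimes> s \<otimes> x \<otimes> v) < len v"
        using len_cocycle[of s x v] sS x v by simp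
      define r where "r = inv x \<otimes> s \<otimes> x"
      have rr: "r \<in> refls" unfolding r_def using refl_conj' sS x by simp
      have rv: "len (r \<otimes> v) < len v" using r by (simp add: r_def)
      then have rJ: "r \<in> par J" using refl_descent_par[OF JS vf(1) rr] by blast
      have "x \<otimes> r = s \<otimes> x" unfolding r_def using x sS by (simp add: m_assoc)
      then have "len r \<le> 1" using lenxv[OF rJ] len_mult_le[of s x] sS x by simp
      moreover have "r \<noteq> \<one>" using rv v by auto
      then obtain t where t: "t \<in> J" "len (t \<otimes> r) < len r" using par_descent[OF JS rJ] by blast
      ultimately have "t \<otimes> r = \<one>" using len_eq_0[of "t \<otimes> r"] t JS rr by auto
      then have "r = t" using t JS rr by (metis gen_cancel gen_carrier r_one refl_carrier subsetD)
      moreover have "x \<otimes> r \<otimes> inv x = s" unfolding r_def using x sS by (simp add: m_assoc)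
      ultimately have "r \<in> J'" using t s by (simp add: J'_def)
      then have "len (r \<otimes> v) = len r + len v" using vf(4) par_gen by blast
      then show False using rv by simp
    qed
    then show ?thesis using len_gen_neq[OF sS, of "x \<otimes> v"] x v by (intro le_gen_mult sS) auto
  qed
  then have "len (w \<otimes> (x \<otimes> v)) = len w + len (x \<otimes> v)"
    using len_par_mult[OF IS w(2), of "x \<otimes> v"] x v by blast
  then have lenyv: "len (y \<otimes> v) = len y + len v"
    using lenxv[OF vf(1)] leny w x v by (simp add: y_def m_assoc)
  \<comment> \<open>The part \<open>W_J'\<close> is absorbed by \<open>below y\<close>; what
    remains, \<open>below y\<close> times \<open>below v\<close>, is \<open>below (y v)\<close>
    since lengths add.\<close>
  have parJ: "par J = par J' <#> below v"
    using below_mult[of "longest W S J'" v] longest_props(2)[OF J] longest_props(2)[OF J'(3)]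
      vf(2,3) v longest_carrier[OF J'(3)] by simp
  have bp: "below (coset_max W S p) = below y <#> par J"
    using max(3)[OF x(2)] belowy by simp
  also have "\<dots> = below y <#> par J' <#> below v"
    unfolding parJ using below_carrier par_closed[OF J'(2)] by (simp add: set_mult_assoc)
  also have "\<dots> = below (y \<otimes> v)" using absorb below_mult[OF y v lenyv] by simp
  finally have "coset_max W S p = y \<otimes> v"
    using below_inject max(1) double_coset_carrier[OF IS JS p] y v by blast
  moreover have "y \<otimes> inv (longest W S J') \<otimes> longest W S J = y \<otimes> v"
    unfolding v_def using y longest_carrier[OF J] longest_carrier[OF J'(3)] by (simp add: m_assoc)
  moreover have "int (len y) - len (longest W S J') + len (longest W S J) = len (y \<otimes> v)"
    using lenyv vf(3) by simp
  ultimately show ?case using E bp by simp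
qed

text \<open>The product of parabolics, carried along with the factors, identifies the star product
  by injectivity of \<open>below\<close>; the other two data give reducedness.\<close>

lemma reduced_expression_exists:
  assumes "finitary W S I" "finitary W S J" "q \<in> double_cosets W I J"
  shows "\<exists>Is. reduced_expresses W S I J Is q"
proof -
  obtain Is where Is: "is_expression W S Is" "hd Is = I" "last Is = J"
    "gen_prod Is = below (coset_max W S q)"
    "wprod (expression_factors W S Is) = coset_max W S q"
    "int (sum_list (map len (expression_factors W S Is))) = len (coset_max W S q)"
    using reduced_expression_with[OF assms] unfolding expression_with_def by blast
  have "coset_max W S q \<in> carrier W"
    using coset_max_props(1)[OF assms] double_coset_carrier finitary_par(1) assms by blast
  then have "coset_max W S q = star_prod W S (map (longest W S) Is)"
    using below_star_prod[OF is_expression_finitary[OF Is(1)]] Is(4) below_inject by auto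
  then have "reduced_expresses W S I J Is q"
    unfolding reduced_expresses_def expresses_def using Is assms(3) by auto
  then show ?thesis ..
qed

end

theorem theorem2p16:
  fixes W :: "('a, 'b) monoid_scheme" and S I J p q :: "'a set"
  assumes "coxeter_system W S"
    and "finitary W S I" and "finitary W S J"
    and "p \<in> double_cosets W I J" and "q \<in> double_cosets W I J"
  shows
    "(bruhat_le W S (coset_max W S p) (coset_max W S q)
        \<longleftrightarrow> bruhat_le W S (coset_min W S p) (coset_min W S q)) \<and>
     (bruhat_le W S (coset_min W S p) (coset_min W S q)
        \<longleftrightarrow> (\<exists>Is ps. reduced_expresses W S I J Is q \<and> subordinate_path W Is ps \<and> p = last ps)) \<and>
     ((\<exists>Is ps. reduced_expresses W S I J Is q \<and> subordinate_path W Is ps \<and> p = last ps)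
        \<longleftrightarrow> (\<forall>Is. expresses W S I J Is q \<longrightarrow> (\<exists>ps. subordinate_path W Is ps \<and> p = last ps)))"
proof -
  interpret coxeter_system W S by (rule assms(1))
  have red: "expresses W S I J Is q" if "reduced_expresses W S I J Is q" for Is
    using that by (simp add: reduced_expresses_def)
  \<comment> \<open>This expression lets the universal condition imply the existential one; all
    other implications hold for each expression separately.\<close>
  obtain Is where Is: "reduced_expresses W S I J Is q"
    using reduced_expression_exists[OF assms(2,3,5)] by blast
  show ?thesis
    using coset_max_le_iff_coset_min_le[OF assms(2-5)] path_to_iff_le[OF _ assms(4)] red Is by metis
qed

end
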